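(* Let $A$, $B$, $B_1$, $C_1$, $C_1-B_1$ and $\mathbb{Y}$ be positive stable matrices in $\mathbb{C}^{r\times r}$ with $B_1C_1=C_1B_1$, and let $z\in\mathbb{C}$. Then $${}_1F_1^{(A,B;\mathbb{Y})}(B_1;C_1;z)=\int_0^1\exp(zt)\,{}_1F_1\!\left(A;B;-\frac{\mathbb{Y}}{t(1-t)}\right)t^{B_1-I}(1-t)^{C_1-B_1-I}\,dt\;[\mathfrak{B}(B_1,C_1-B_1)]^{-1}$$ and $${}_1F_1^{(A,B;\mathbb{Y})}(B_1;C_1;z)=\int_0^1\exp(z(1-u))\,{}_1F_1\!\left(A;B;\frac{-\mathbb{Y}}{u(1-u)}\right)u^{C_1-B_1-I}(1-u)^{B_1-I}\,du\;[\mathfrak{B}(B_1,C_1-B_1)]^{-1}.$$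
   Context: A matrix in $\mathbb{C}^{r\times r}$ is positive stable if all its eigenvalues have positive real part; $I$ is the identity matrix. For $t>0$ and a square matrix $M$, $t^M=\exp(M\ln t)$. The Pochhammer symbol is $(M)_0=I$, $(M)_n=M(M+I)\cdots(M+(n-1)I)$ for $n\ge1$. For positive stable $B$ and a square matrix $W$, ${}_1F_1(A;B;W)=\sum_{n\ge0}(A)_n\,[(B)_n]^{-1}\,\frac{W^n}{n!}$. For commuting positive stable $P,Q$, the beta matrix function is $\mathfrak{B}(P,Q)=\Gamma(P)\Gamma(Q)\Gamma^{-1}(P+Q)=\int_0^1t^{P-I}(1-t)^{Q-I}dt$, where $\Gamma(P)=\int_0^\infty e^{-t}t^{P-I}dt$. For positive stable $A,B,P,Q,\mathbb{Y}$, $$\mathfrak{B}_{\mathbb{Y}}^{(A,B)}(P,Q)=\int_0^1 {}_1F_1\!\left(A;B;-\frac{\mathbb{Y}}{t(1-t)}\right)t^{P-I}(1-t)^{Q-I}\,dt .$$ The new extended confluent hypergeometric matrix function is $${}_1F_1^{(A,B;\mathbb{Y})}(B_1;C_1;z)=\sum_{n=0}^\infty \mathfrak{B}_{\mathbb{Y}}^{(A,B)}(B_1+nI,C_1-B_1)\,[\mathfrak{B}(B_1,C_1-B_1)]^{-1}\,\frac{z^n}{n!}.$$ *)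

theory Defs
  imports "HOL-Analysis.Analysis"
begin

text \<open>
  Matrices in C^(r x r) have type \<open>complex^'r^'r\<close>. On this type \<open>*\<close>, \<open>1\<close>, \<open>^\<close> are the
  componentwise operations of the class instances for \<open>vec\<close>, so the matrix product \<open>**\<close>, the
  identity \<open>mat 1\<close> and the power \<open>mpow\<close> are used instead. Infinite sums and integrals are taken in
  the finite-dimensional Banach space \<open>complex^'r^'r\<close>, i.e. entrywise.
\<close>

definition positive_stable :: "complex^'r^'r \<Rightarrow> bool" where
  "positive_stable M \<longleftrightarrow> (\<forall>l v. v \<noteq> 0 \<and> M *v v = l *s v \<longrightarrow> Re l > 0)"

definition cscale :: "complex \<Rightarrow> complex^'r^'r \<Rightarrow> complex^'r^'r" (infixr \<open>*\<^sub>M\<close> 75) where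
  "c *\<^sub>M M = (\<chi> i j. c * M $ i $ j)"

primrec mpow :: "complex^'r^'r \<Rightarrow> nat \<Rightarrow> complex^'r^'r" where
  "mpow M 0 = mat 1"
| "mpow M (Suc n) = mpow M n ** M"

definition mexp :: "complex^'r^'r \<Rightarrow> complex^'r^'r" where
  "mexp M = (\<Sum>n. mpow M n /\<^sub>R fact n)"

text \<open>The power \<open>t^M = exp (M ln t)\<close>, meaningful for \<open>t > 0\<close> only.\<close>

definition mpowr :: "real \<Rightarrow> complex^'r^'r \<Rightarrow> complex^'r^'r" where
  "mpowr t M = mexp (ln t *\<^sub>R M)"

primrec mpoch :: "complex^'r^'r \<Rightarrow> nat \<Rightarrow> complex^'r^'r" where
  "mpoch M 0 = mat 1"
| "mpoch M (Suc n) = mpoch M n ** (M + real n *\<^sub>R mat 1)"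

definition hyp_1F1 :: "complex^'r^'r \<Rightarrow> complex^'r^'r \<Rightarrow> complex^'r^'r \<Rightarrow> complex^'r^'r" where
  "hyp_1F1 A B W = (\<Sum>n. (mpoch A n ** matrix_inv (mpoch B n) ** mpow W n) /\<^sub>R fact n)"

definition mGamma :: "complex^'r^'r \<Rightarrow> complex^'r^'r" where
  "mGamma P = (LINT t:{0<..}|lborel. exp (- t) *\<^sub>R mpowr t (P - mat 1))"

text \<open>For commuting positive stable \<open>P\<close>, \<open>Q\<close>.\<close>

definition mBeta :: "complex^'r^'r \<Rightarrow> complex^'r^'r \<Rightarrow> complex^'r^'r" where
  "mBeta P Q = mGamma P ** mGamma Q ** matrix_inv (mGamma (P + Q))"

text \<open>\<open>ext_Beta A B Y P Q\<close> has upper parameters \<open>(A, B)\<close> and lower parameter \<open>Y\<close>. The open interval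
  avoids the endpoints, where the integrand is not defined.\<close>

definition ext_Beta ::
  "complex^'r^'r \<Rightarrow> complex^'r^'r \<Rightarrow> complex^'r^'r \<Rightarrow> complex^'r^'r \<Rightarrow> complex^'r^'r \<Rightarrow> complex^'r^'r"
  where
  "ext_Beta A B Y P Q =
    (LINT t:{0<..<1}|lborel.
      hyp_1F1 A B (- (Y /\<^sub>R (t * (1 - t)))) ** mpowr t (P - mat 1) ** mpowr (1 - t) (Q - mat 1))"

definition ext_hyp_1F1_term ::
  "complex^'r^'r \<Rightarrow> complex^'r^'r \<Rightarrow> complex^'r^'r \<Rightarrow> complex^'r^'r \<Rightarrow> complex^'r^'r \<Rightarrow>
    complex \<Rightarrow> nat \<Rightarrow> complex^'r^'r"
  where
  "ext_hyp_1F1_term A B Y B1 C1 z n =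
    (z ^ n / fact n) *\<^sub>M
      (ext_Beta A B Y (B1 + real n *\<^sub>R mat 1) (C1 - B1) ** matrix_inv (mBeta B1 (C1 - B1)))"

definition ext_hyp_1F1 ::
  "complex^'r^'r \<Rightarrow> complex^'r^'r \<Rightarrow> complex^'r^'r \<Rightarrow> complex^'r^'r \<Rightarrow> complex^'r^'r \<Rightarrow>
    complex \<Rightarrow> complex^'r^'r"
  where
  "ext_hyp_1F1 A B Y B1 C1 z = (\<Sum>n. ext_hyp_1F1_term A B Y B1 C1 z n)"

end

theory Submission
  imports Defs "HOL-Computational_Algebra.Fundamental_Theorem_Algebra"
begin

text \<open>
  Once the integrand at \<open>z = 0\<close> is known to be integrable on \<open>(0,1)\<close>, the first formula is the exchange of
  the sum over \<open>n\<close> with the integral (the factor \<open>t^n\<close> is at most 1), and the second is the reflection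
  \<open>t = 1 - u\<close>. For integrability, \<open>t^(P-I) (1-t)^(Q-I)\<close> is dominated by a scalar beta density, because
  \<open>exp (- s P)\<close> decays exponentially for positive stable \<open>P\<close>; so it suffices that \<open>1F1(A;B;-sY)\<close> is bounded
  for \<open>s \<ge> 0\<close>, although \<open>A\<close>, \<open>B\<close>, \<open>Y\<close> need not commute and \<open>A\<close> need not be small compared to \<open>B\<close>.
  To this end choose \<open>m\<close> such that \<open>(m+1)I - A\<close> is positive stable. Then \<open>(A)_n / (m+1)_n\<close> and \<open>n! (B)_(n+1)^(-1)\<close>
  are moments of integrable kernels on \<open>(0,1)\<close>, up to an invertible constant factor for the former. Summing
  the series under both integrals leaves the integral of \<open>q(W) exp W\<close> with a polynomial \<open>q\<close> and \<open>W = - s t v Y\<close>,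
  and its exponential decay gives the bound.
\<close>

subsection \<open>Matrix products and the matrix exponential\<close>

text \<open>The bound on \<open>hyp_1F1\<close> cannot be read off the series termwise: the terms
  grow with s and only their cancellation keeps the sum bounded. The integrals restore the
  cancellation because W stands rightmost in every term: all other factors stay on the left, and
  only a weighted exponential of a multiple of Y has to be estimated. Noncommutativity shapes the
  two kernels. The beta recursion carries the factor P + Q + n I, so the Pochhammer symbol of A
  separates cleanly when the second parameter completes A to a scalar matrix; an integer scalar m +
  1 makes the surplus weight (m+1)_(n+1) / (n+1)! a binomial coefficient, hence a polynomial in n.
  For B, moments (c)_n / (B)_n would ask for B - c I to be positive stable; passing to (B)_(n+1)
  permits the parameters (1, B) instead. The price is that the term n = 0 is split off and a factor
  W remains, which grows like s; integrating x exp (- \<delta> x t) over t absorbs it.\<close>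

lemma norm_matrix_mult_le:
  fixes A :: "complex^'n^'m" and B :: "complex^'p^'n"
  shows "norm (A ** B) \<le> norm A * norm B"
proof (rule power2_le_imp_le)
  have sq: "(norm X)\<^sup>2 = (\<Sum>i\<in>UNIV. \<Sum>j\<in>UNIV. (norm (X $ i $ j))\<^sup>2)"
    for X :: "complex^'b^'a"
    by (simp add: norm_vec_def L2_set_def real_sqrt_pow2 sum_nonneg)
  have entry: "(norm ((A ** B) $ i $ j))\<^sup>2
      \<le> (\<Sum>k\<in>UNIV. (norm (A $ i $ k))\<^sup>2) * (\<Sum>k\<in>UNIV. (norm (B $ k $ j))\<^sup>2)" for i j
  proof -
    have "norm ((A ** B) $ i $ j) \<le> (\<Sum>k\<in>UNIV. norm (A $ i $ k) * norm (B $ k $ j))"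
      by (simp add: matrix_matrix_mult_def norm_mult [symmetric] norm_sum)
    then have "(norm ((A ** B) $ i $ j))\<^sup>2 \<le> (\<Sum>k\<in>UNIV. norm (A $ i $ k) * norm (B $ k $ j))\<^sup>2"
      by (intro power_mono) auto
    also have "\<dots> \<le> (\<Sum>k\<in>UNIV. (norm (A $ i $ k))\<^sup>2) * (\<Sum>k\<in>UNIV. (norm (B $ k $ j))\<^sup>2)"
      by (rule Cauchy_Schwarz_ineq_sum)
    finally show ?thesis .
  qed
  have "(norm (A ** B))\<^sup>2 \<le> (\<Sum>i\<in>UNIV. \<Sum>j\<in>UNIV.
      (\<Sum>k\<in>UNIV. (norm (A $ i $ k))\<^sup>2) * (\<Sum>k\<in>UNIV. (norm (B $ k $ j))\<^sup>2))"
    unfolding sq by (intro sum_mono entry)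
  also have "\<dots> = (norm A)\<^sup>2 * (\<Sum>j\<in>UNIV. \<Sum>k\<in>UNIV. (norm (B $ k $ j))\<^sup>2)"
    unfolding sq by (simp only: sum_distrib_left [symmetric] sum_distrib_right [symmetric])
  also have "\<dots> = (norm A)\<^sup>2 * (norm B)\<^sup>2"
    unfolding sq [of B] by (subst sum.swap) simp
  finally show "(norm (A ** B))\<^sup>2 \<le> (norm A * norm B)\<^sup>2"
    by (simp add: power_mult_distrib)
qed simp

text \<open>The norm of the nested vector type is the Frobenius norm, for which Cauchy-Schwarz gives
  submultiplicativity with constant 1. Bilinearity then opens the general rules for derivatives,
  series and integrals to \<open>**\<close>.\<close>

lemma bounded_bilinear_matrix_mult:
  "bounded_bilinear ((**) :: complex^'n^'m \<Rightarrow> complex^'p^'n \<Rightarrow> complex^'p^'m)"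
proof
  show "\<exists>K. \<forall>a b. norm ((a :: complex^'n^'m) ** (b :: complex^'p^'n)) \<le> norm a * norm b * K"
    by (intro exI [of _ 1]) (simp add: norm_matrix_mult_le)
qed (simp_all add: matrix_matrix_mult_def vec_eq_iff sum.distrib algebra_simps scaleR_sum_right)

interpretation mm: bounded_bilinear "(**) :: complex^'n^'m \<Rightarrow> complex^'p^'n \<Rightarrow> complex^'p^'m"
  by (rule bounded_bilinear_matrix_mult)

lemmas matrix_simps = mm.add_left mm.add_right mm.scaleR_left mm.scaleR_right
  mm.diff_left mm.diff_right mm.minus_left mm.minus_right

text \<open>For square matrices a one-sided inverse is two-sided, which pins down the Hilbert choice
  in \<open>matrix_inv\<close>.\<close>

lemma matrix_invD:
  fixes X Y :: "complex^'r^'r"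
  assumes "X ** Y = mat 1"
  shows "Y ** X = mat 1" and "matrix_inv X = Y"
proof -
  show YX: "Y ** X = mat 1"
    using assms matrix_left_right_inverse by blast
  have "X ** matrix_inv X = mat 1"
    unfolding matrix_inv_def by (rule someI2 [of _ Y]) (use assms YX in auto)
  then have "Y ** (X ** matrix_inv X) = Y"
    by simp
  then show "matrix_inv X = Y"
    by (simp add: matrix_mul_assoc YX)
qed

lemma mpow_scaleR: "mpow (c *\<^sub>R M) n = c ^ n *\<^sub>R mpow M n"
  by (induction n) (simp_all add: matrix_simps mult.commute)

lemma mpow_commute: "M ** N = N ** M \<Longrightarrow> mpow M n ** N = N ** mpow M n"
  by (induction n) (simp_all, metis matrix_mul_assoc)

lemma mpow_add: "mpow M (m + n) = mpow M m ** mpow M n"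
  by (induction n) (simp_all add: matrix_mul_assoc)

lemma norm_mpow_le: "norm (mpow M n) \<le> norm (mat 1 :: complex^'r^'r) * norm (M :: complex^'r^'r) ^ n"
proof (induction n)
  case (Suc n)
  have "norm (mpow M (Suc n)) \<le> norm (mpow M n) * norm M"
    by (simp add: norm_matrix_mult_le)
  also have "\<dots> \<le> norm (mat 1 :: complex^'r^'r) * norm M ^ n * norm M"
    by (intro mult_right_mono Suc.IH) simp
  finally show ?case
    by (simp add: mult_ac)
qed simp

lemma summable_norm_mexp:
  fixes M :: "complex^'r^'r"
  shows "summable (\<lambda>n. norm (mpow M n /\<^sub>R fact n))"
proof (rule summable_comparison_test')
  show "summable (\<lambda>n. norm (mat 1 :: complex^'r^'r) * (norm M ^ n /\<^sub>R fact n))"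
    by (intro summable_mult summable_exp_generic)
  show "norm (norm (mpow M n /\<^sub>R fact n)) \<le> norm (mat 1 :: complex^'r^'r) * (norm M ^ n /\<^sub>R fact n)"
    for n
    using norm_mpow_le [of M n] by (simp add: field_simps)
qed

lemma mexp_sums: "(\<lambda>n. mpow M n /\<^sub>R fact n) sums mexp M"
  unfolding mexp_def by (rule summable_sums [OF summable_norm_cancel [OF summable_norm_mexp]])

lemma mexp_0 [simp]: "mexp (0 :: complex^'r^'r) = mat 1"
proof -
  have "(\<lambda>n. mpow (0 :: complex^'r^'r) n /\<^sub>R fact n) = (\<lambda>n. if n = 0 then mat 1 else 0)"
    by (rule ext, case_tac n) simp_all
  moreover have "\<dots> sums (mat 1 :: complex^'r^'r)"
    by (rule sums_single)
  ultimately show ?thesis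
    using mexp_sums [of "0 :: complex^'r^'r"] by (simp add: sums_unique2)
qed

lemma mexp_commute:
  assumes "M ** N = N ** M"
  shows "mexp M ** N = N ** mexp M"
proof -
  have "(\<lambda>n. (mpow M n /\<^sub>R fact n) ** N) sums (mexp M ** N)"
    by (rule bounded_linear.sums [OF mm.bounded_linear_left mexp_sums])
  moreover have "(\<lambda>n. N ** (mpow M n /\<^sub>R fact n)) sums (N ** mexp M)"
    by (rule bounded_linear.sums [OF mm.bounded_linear_right mexp_sums])
  ultimately show ?thesis
    by (simp add: matrix_simps mpow_commute [OF assms] sums_unique2)
qed

text \<open>In each coordinate the exponential is a real power series in t that converges
  everywhere, so scalar termwise differentiation applies.\<close>

lemma has_vector_derivative_mexp:
  "((\<lambda>t. mexp (t *\<^sub>R M)) has_vector_derivative mexp (t *\<^sub>R M) ** M) (at t within S)"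
  unfolding has_vector_derivative_def
proof (subst has_derivative_componentwise_within, intro ballI)
  fix b :: "complex^'a^'a"
  define c where "c n = (mpow M n /\<^sub>R fact n) \<bullet> b" for n
  have c: "(\<lambda>n. c n * t ^ n) sums (mexp (t *\<^sub>R M) \<bullet> b)" for t
    using bounded_linear.sums [OF bounded_linear_inner_left mexp_sums [of "t *\<^sub>R M"], of b]
    by (simp add: c_def mpow_scaleR mult_ac)
  have "(\<lambda>n. ((mpow (t *\<^sub>R M) n /\<^sub>R fact n) ** M) \<bullet> b) sums ((mexp (t *\<^sub>R M) ** M) \<bullet> b)"
    by (intro bounded_linear.sums [OF bounded_linear_inner_left] bounded_linear.sums [OF mm.bounded_linear_left] mexp_sums)
  moreover have "((mpow (t *\<^sub>R M) n /\<^sub>R fact n) ** M) \<bullet> b = diffs c n * t ^ n" for n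
    by (simp add: diffs_def c_def mpow_scaleR matrix_simps del: of_nat_Suc)
  ultimately have d: "(\<Sum>n. diffs c n * t ^ n) = (mexp (t *\<^sub>R M) ** M) \<bullet> b"
    by (simp add: sums_iff)
  have "((\<lambda>t. \<Sum>n. c n * t ^ n) has_field_derivative (\<Sum>n. diffs c n * t ^ n)) (at t)"
    by (rule termdiffs_strong_converges_everywhere) (use c in \<open>auto simp: sums_iff\<close>)
  moreover have "(\<lambda>t. \<Sum>n. c n * t ^ n) = (\<lambda>t. mexp (t *\<^sub>R M) \<bullet> b)"
    using c by (simp add: sums_iff)
  ultimately have "((\<lambda>t. mexp (t *\<^sub>R M) \<bullet> b) has_real_derivative (mexp (t *\<^sub>R M) ** M) \<bullet> b) (at t within S)"
    by (simp add: d has_field_derivative_at_within)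
  then show "((\<lambda>t. mexp (t *\<^sub>R M) \<bullet> b) has_derivative (\<lambda>x. (x *\<^sub>R (mexp (t *\<^sub>R M) ** M)) \<bullet> b)) (at t within S)"
    by (simp add: has_real_derivative_iff_has_vector_derivative has_vector_derivative_def)
qed

lemma has_vector_derivative_matrix_mult:
  fixes f :: "real \<Rightarrow> complex^'r^'r"
  assumes "(f has_vector_derivative f') (at t within S)" "(g has_vector_derivative g') (at t within S)"
  shows "((\<lambda>t. f t ** g t) has_vector_derivative f t ** g' + f' ** g t) (at t within S)"
  by (rule mm.has_vector_derivative [OF assms])

lemma has_vector_derivative_zero_imp_eq:
  fixes f :: "real \<Rightarrow> 'a::real_normed_vector"
  assumes "\<And>t. (f has_vector_derivative 0) (at t within UNIV)"
  shows "f s = f t"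
proof -
  obtain c where "\<And>x. x \<in> UNIV \<Longrightarrow> f x = c"
    by (rule has_vector_derivative_zero_constant [OF convex_UNIV, of f]) (use assms in auto)
  then show ?thesis
    by simp
qed

lemma mexp_add:
  assumes "M ** N = N ** M"
  shows "mexp (M + N) = mexp M ** mexp N"
proof -
  \<comment> \<open>Obtained first, by the same constancy argument, since it supplies the inverse
    that cancels \<open>mexp (- (M + N))\<close> at the end.\<close>
  have neg: "mexp (- M) ** mexp M = mat 1" for M :: "complex^'a^'a"
  proof -
    have "((\<lambda>t. mexp (t *\<^sub>R (- M)) ** mexp (t *\<^sub>R M)) has_vector_derivative 0) (at t within UNIV)" for t
    proof (rule has_vector_derivative_eq_rhs, rule has_vector_derivative_matrix_mult; (rule has_vector_derivative_mexp)?)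
      have "mexp (t *\<^sub>R M) ** M = M ** mexp (t *\<^sub>R M)"
        by (intro mexp_commute) (simp add: matrix_simps)
      then show "mexp (t *\<^sub>R - M) ** (mexp (t *\<^sub>R M) ** M) + mexp (t *\<^sub>R - M) ** - M ** mexp (t *\<^sub>R M) = 0"
        by (simp add: matrix_simps flip: matrix_mul_assoc)
    qed
    from has_vector_derivative_zero_imp_eq [OF this, of 1 0] show ?thesis
      by simp
  qed
  \<comment> \<open>This product is constant in t and equals \<open>mat 1\<close> at 0; the argument
    takes the place of a Cauchy product of series.\<close>
  let ?f = "\<lambda>t. mexp (t *\<^sub>R (- (M + N))) ** (mexp (t *\<^sub>R M) ** mexp (t *\<^sub>R N))"
  have "(?f has_vector_derivative 0) (at t within UNIV)" for t
  proof (rule has_vector_derivative_eq_rhs, rule has_vector_derivative_matrix_mult,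
      rule has_vector_derivative_mexp, rule has_vector_derivative_matrix_mult; (rule has_vector_derivative_mexp)?)
    have 1: "mexp (t *\<^sub>R M) ** M = M ** mexp (t *\<^sub>R M)" "mexp (t *\<^sub>R M) ** N = N ** mexp (t *\<^sub>R M)"
      "mexp (t *\<^sub>R N) ** N = N ** mexp (t *\<^sub>R N)"
      by (intro mexp_commute; simp add: matrix_simps assms)+
    show "mexp (t *\<^sub>R - (M + N)) ** (mexp (t *\<^sub>R M) ** (mexp (t *\<^sub>R N) ** N) + mexp (t *\<^sub>R M) ** M ** mexp (t *\<^sub>R N))
      + mexp (t *\<^sub>R - (M + N)) ** - (M + N) ** (mexp (t *\<^sub>R M) ** mexp (t *\<^sub>R N)) = 0"
    proof -
      have "mexp (t *\<^sub>R M) ** (mexp (t *\<^sub>R N) ** N) = N ** (mexp (t *\<^sub>R M) ** mexp (t *\<^sub>R N))"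
        by (simp only: 1 matrix_mul_assoc)
      moreover have "mexp (t *\<^sub>R M) ** M ** mexp (t *\<^sub>R N) = M ** (mexp (t *\<^sub>R M) ** mexp (t *\<^sub>R N))"
        by (simp only: 1 matrix_mul_assoc)
      ultimately show ?thesis
        by (simp add: matrix_simps flip: matrix_mul_assoc)
    qed
  qed
  from has_vector_derivative_zero_imp_eq [OF this, of 1 0] have "mexp (- (M + N)) ** (mexp M ** mexp N) = mat 1"
    by simp
  then have "mexp (M + N) ** (mexp (- (M + N)) ** (mexp M ** mexp N)) = mexp (M + N)"
    by simp
  moreover have "mexp (M + N) ** mexp (- (M + N)) = mat 1"
    using neg [of "- (M + N)"] by (simp only: minus_minus)
  ultimately show ?thesis
    by (metis matrix_mul_assoc matrix_mul_lid)
qed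

lemma mexp_minus: "mexp (- M) ** mexp M = mat 1"
  using mexp_add [of "- M" M] by (simp add: matrix_simps)

lemma mexp_scaleR_mat: "mexp (c *\<^sub>R mat 1 :: complex^'r^'r) = exp c *\<^sub>R mat 1"
proof -
  have "mpow (mat 1 :: complex^'r^'r) n = mat 1" for n
    by (induction n) simp_all
  then have "(\<lambda>n. (c ^ n /\<^sub>R fact n) *\<^sub>R mat 1) sums mexp (c *\<^sub>R mat 1 :: complex^'r^'r)"
    using mexp_sums [of "c *\<^sub>R mat 1 :: complex^'r^'r"] by (simp add: mpow_scaleR mult_ac)
  moreover have "(\<lambda>n. (c ^ n /\<^sub>R fact n) *\<^sub>R mat 1) sums (exp c *\<^sub>R mat 1 :: complex^'r^'r)"
    by (intro bounded_linear.sums [OF bounded_linear_scaleR_left] exp_converges)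
  ultimately show ?thesis
    by (rule sums_unique2)
qed

subsection \<open>Exponential decay for positive stable matrices\<close>

lemma cscale_simps:
  fixes A B :: "complex^'r^'r"
  shows cscale_mult_left: "(c *\<^sub>M A) ** B = c *\<^sub>M (A ** B)"
    and cscale_mult_right: "A ** (c *\<^sub>M B) = c *\<^sub>M (A ** B)"
    and cscale_cscale: "c *\<^sub>M (d *\<^sub>M A) = (c * d) *\<^sub>M A"
    and cscale_one: "1 *\<^sub>M A = A"
    and cscale_of_real: "complex_of_real x *\<^sub>M A = x *\<^sub>R A"
  by (simp_all add: cscale_def matrix_matrix_mult_def vec_eq_iff sum_distrib_left algebra_simps
      scaleR_conv_of_real [where 'a = complex])

lemma norm_cscale: "norm (c *\<^sub>M A) = norm c * norm A"
proof -
  have "norm ((c *\<^sub>M A) $ i) = norm c * norm (A $ i)" for i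
    by (simp add: cscale_def norm_vec_def norm_mult L2_set_right_distrib)
  then show ?thesis
    by (simp add: norm_vec_def [where 'b = 'a] norm_vec_def [of "c *\<^sub>M A"] norm_vec_def [of A] L2_set_right_distrib)
qed

interpretation cs: bounded_bilinear "(*\<^sub>M) :: complex \<Rightarrow> complex^'r^'r \<Rightarrow> complex^'r^'r"
proof
  show "\<exists>K. \<forall>a b. norm (a *\<^sub>M (b :: complex^'r^'r)) \<le> norm a * norm b * K"
    by (intro exI [of _ 1]) (simp add: norm_cscale)
qed (simp_all add: cscale_def vec_eq_iff algebra_simps)

text \<open>Accumulating the factors M - l I in the last argument lets an induction over the list
  absorb them into W one by one.\<close>

primrec shift_product :: "complex^'r^'r \<Rightarrow> complex list \<Rightarrow> complex^'r^'r \<Rightarrow> complex^'r^'r" where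
  "shift_product M [] W = W"
| "shift_product M (l # ls) W = shift_product M ls ((M - l *\<^sub>M mat 1) ** W)"

text \<open>Decay for (M - l I) W passes to W by one integration. Since \<delta> lies strictly below
  every Re l, the rate survives each step, and the polynomial factors of nondiagonalisable blocks
  never appear.\<close>

lemma mexp_decay_shift_product:
  fixes M W :: "complex^'r^'r"
  assumes "\<forall>l\<in>set ls. \<delta> < Re l" and "shift_product M ls W = 0"
  shows "\<exists>C. \<forall>s\<ge>0. norm (mexp ((- s) *\<^sub>R M) ** W) \<le> C * exp (- \<delta> * s)"
  using assms
proof (induction ls arbitrary: W)
  case Nil
  then show ?case
    by (intro exI [of _ 0]) simp
next
  case (Cons l ls)
  define V where "V = (M - l *\<^sub>M mat 1) ** W"
  obtain C where C: "\<And>s. s \<ge> 0 \<Longrightarrow> norm (mexp ((- s) *\<^sub>R M) ** V) \<le> C * exp (- \<delta> * s)"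
    using Cons.IH [of V] Cons.prems by (auto simp: V_def)
  have C0: "C \<ge> 0"
    using order_trans [OF norm_ge_zero C [of 0]] by simp
  define \<epsilon> where "\<epsilon> = Re l - \<delta>"
  have \<epsilon>: "\<epsilon> > 0"
    using Cons.prems by (simp add: \<epsilon>_def)
  \<comment> \<open>The integrating factor cancels the eigenvalue l: the derivative of f contains V
    in place of W, so by induction it is at most of order exp (\<epsilon> s).\<close>
  define f where "f s = exp (l * of_real s) *\<^sub>M (mexp ((- s) *\<^sub>R M) ** W)" for s
  have exp': "((\<lambda>s. exp (l * of_real s)) has_vector_derivative l * exp (l * of_real s)) (at s)" for s :: real
    by (rule has_vector_derivative_real_field) (auto intro!: derivative_eq_intros)
  have mexp': "((\<lambda>s. mexp ((- s) *\<^sub>R M)) has_vector_derivative - (mexp ((- s) *\<^sub>R M) ** M)) (at s)" for s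
    using has_vector_derivative_mexp [of "- M" s UNIV] by (simp add: matrix_simps)
  have f': "(f has_vector_derivative - (exp (l * of_real s) *\<^sub>M (mexp ((- s) *\<^sub>R M) ** V))) (at s)" for s
    unfolding f_def
  proof (rule has_vector_derivative_eq_rhs, rule cs.has_vector_derivative, rule exp',
      rule bounded_linear.has_vector_derivative [OF mm.bounded_linear_left mexp'])
    show "exp (l * of_real s) *\<^sub>M (- (mexp ((- s) *\<^sub>R M) ** M) ** W)
        + (l * exp (l * of_real s)) *\<^sub>M (mexp ((- s) *\<^sub>R M) ** W)
      = - (exp (l * of_real s) *\<^sub>M (mexp ((- s) *\<^sub>R M) ** V))"
      by (simp add: V_def matrix_simps cscale_mult_left cscale_mult_right cs.diff_right cs.minus_right
          cscale_cscale mult.commute flip: matrix_mul_assoc)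
  qed
  \<comment> \<open>A primitive of the bound on the derivative of f, for the mean value
    inequality.\<close>
  define \<phi> where "\<phi> s = C / \<epsilon> * exp (\<epsilon> * s)" for s
  have \<phi>': "(\<phi> has_vector_derivative C * exp (\<epsilon> * s)) (at s)" for s
    unfolding \<phi>_def using \<epsilon>
    by (auto intro!: derivative_eq_intros simp flip: has_real_derivative_iff_has_vector_derivative)
  have bound: "norm (- (exp (l * of_real s) *\<^sub>M (mexp ((- s) *\<^sub>R M) ** V))) \<le> C * exp (\<epsilon> * s)"
    if "s > 0" for s
  proof -
    have "norm (exp (l * of_real s) *\<^sub>M (mexp ((- s) *\<^sub>R M) ** V)) \<le> exp (Re l * s) * (C * exp (- \<delta> * s))"
      unfolding norm_cscale by (intro mult_mono C) (use that C0 in auto)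
    also have "\<dots> = C * exp (\<epsilon> * s)"
      by (simp add: \<epsilon>_def algebra_simps flip: exp_add)
    finally show ?thesis by simp
  qed
  have fs: "norm (f s) \<le> (norm W + C / \<epsilon>) * exp (\<epsilon> * s)" if "s \<ge> 0" for s
  proof -
    have "norm (f s - f 0) \<le> \<phi> s - \<phi> 0"
    proof (cases "s = 0")
      case False
      show ?thesis
      proof (rule differentiable_bound_general [OF _ _ _ f' \<phi>'])
        show "continuous_on {0..s} f" "continuous_on {0..s} \<phi>"
          using f' \<phi>' by (meson continuous_at_imp_continuous_on has_vector_derivative_continuous)+
      qed (use that False bound in auto)
    qed simp
    then have "norm (f s) \<le> norm (f 0) + (\<phi> s - \<phi> 0)"
      by (smt (verit) norm_triangle_sub)
    also have "\<dots> \<le> norm W + \<phi> s"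
      using C0 \<epsilon> by (simp add: f_def \<phi>_def cscale_one)
    also have "\<dots> \<le> norm W * exp (\<epsilon> * s) + \<phi> s"
      using \<epsilon> that by (simp add: mult_le_cancel_left1)
    finally show ?thesis
      by (simp add: \<phi>_def algebra_simps)
  qed
  have "norm (mexp ((- s) *\<^sub>R M) ** W) \<le> (norm W + C / \<epsilon>) * exp (- \<delta> * s)" if "s \<ge> 0" for s
  proof -
    have "norm (mexp ((- s) *\<^sub>R M) ** W) = exp (- Re l * s) * norm (f s)"
      by (simp add: f_def norm_cscale flip: exp_add)
    also have "\<dots> \<le> exp (- Re l * s) * ((norm W + C / \<epsilon>) * exp (\<epsilon> * s))"
      by (intro mult_left_mono fs that) simp
    also have "\<dots> = (norm W + C / \<epsilon>) * exp (- \<delta> * s)"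
      by (simp add: \<epsilon>_def algebra_simps flip: exp_add)
    finally show ?thesis .
  qed
  then show ?case by blast
qed

text \<open>Horner's scheme as in \<open>poly\<close>, which on this type would multiply
  componentwise.\<close>

definition poly_mat :: "complex poly \<Rightarrow> complex^'r^'r \<Rightarrow> complex^'r^'r" where
  "poly_mat p M = fold_coeffs (\<lambda>a X. a *\<^sub>M mat 1 + M ** X) p 0"

lemma poly_mat_0 [simp]: "poly_mat 0 M = 0"
  by (simp add: poly_mat_def)

lemma poly_mat_pCons [simp]: "poly_mat (pCons a p) M = a *\<^sub>M mat 1 + M ** poly_mat p M"
  by (cases "p = 0 \<and> a = 0") (auto simp: poly_mat_def cs.zero_left)

lemma poly_mat_add: "poly_mat (p + q) M = poly_mat p M + poly_mat q M"
  by (induction p q rule: poly_induct2) (simp_all add: matrix_simps cs.add_left)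

lemma poly_mat_smult: "poly_mat (smult c p) M = c *\<^sub>M poly_mat p M"
  by (induction p) (simp_all add: matrix_simps cs.add_right cs.zero_right cscale_cscale cscale_mult_right)

lemma poly_mat_diff: "poly_mat (p - q) M = poly_mat p M - poly_mat q M"
  using poly_mat_add [of "p - q" q M] by simp

lemma poly_mat_linear_factor: "poly_mat ([:- l, 1:] * q) M = (M - l *\<^sub>M mat 1) ** poly_mat q M"
  by (simp add: poly_mat_add poly_mat_diff poly_mat_smult matrix_simps cscale_mult_left cs.minus_left cs.zero_left)

lemma poly_mat_commute: "poly_mat p M ** M = M ** poly_mat p M"
  by (induction p) (simp_all add: matrix_simps cscale_mult_left cscale_mult_right flip: matrix_mul_assoc)

lemma poly_mat_monom: "poly_mat (monom a n) M = a *\<^sub>M mpow M n"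
proof (induction n)
  case (Suc n)
  have "M ** mpow M n = mpow M n ** M"
    by (simp add: mpow_commute)
  then show ?case
    by (simp add: monom_Suc Suc cs.zero_left cscale_mult_right)
qed (simp add: monom_0)

lemma poly_mat_sum: "poly_mat (sum p I) M = (\<Sum>i\<in>I. poly_mat (p i) M)"
  by (induction I rule: infinite_finite_induct) (simp_all add: poly_mat_add)

text \<open>One power more than the real dimension of the matrix space forces a linear relation
  among the powers.\<close>

lemma ex_annihilating_poly:
  fixes M :: "complex^'r^'r"
  obtains p where "p \<noteq> 0" "poly_mat p M = 0"
proof -
  define N where "N = DIM(complex^'r^'r)"
  show thesis
  \<comment> \<open>Linear dependence speaks of the set of powers, so a coincidence of two powers,
    which shrinks that set, is treated apart.\<close>
  proof (cases "inj_on (mpow M) {..N}")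
    case False
    then obtain i j where ij: "i \<noteq> j" "mpow M i = mpow M j"
      by (auto simp: inj_on_def)
    then have "monom 1 i - monom 1 j \<noteq> (0 :: complex poly)"
      by (auto simp: poly_eq_iff)
    moreover have "poly_mat (monom 1 i - monom 1 j) M = 0"
      by (simp add: poly_mat_diff poly_mat_monom ij)
    ultimately show thesis
      by (rule that)
  next
    case True
    have "card (mpow M ` {..N}) > DIM(complex^'r^'r)"
      by (simp add: card_image True) (simp add: N_def)
    then have "dependent (mpow M ` {..N})"
      by (intro dependent_biggerset) auto
    then obtain u k where u: "k \<le> N" "u (mpow M k) \<noteq> 0" "(\<Sum>v\<in>mpow M ` {..N}. u v *\<^sub>R v) = 0"
      by (auto simp: dependent_finite)
    define p where "p = (\<Sum>i\<le>N. monom (complex_of_real (u (mpow M i))) i)"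
    have "coeff p k = of_real (u (mpow M k))"
      using u(1) by (simp add: p_def coeff_sum)
    with u(2) have "p \<noteq> 0"
      by auto
    moreover have "poly_mat p M = 0"
      using u(3) by (simp add: p_def poly_mat_sum poly_mat_monom cscale_of_real sum.reindex [OF True])
    ultimately show thesis
      by (rule that)
  qed
qed

definition eigenval :: "complex^'r^'r \<Rightarrow> complex \<Rightarrow> bool" where
  "eigenval M l \<longleftrightarrow> (\<exists>v. v \<noteq> 0 \<and> M *v v = l *s v)"

text \<open>A nonzero vector in the range of X would be an eigenvector for l.\<close>

lemma shift_cancel:
  fixes M X :: "complex^'r^'r"
  assumes "\<not> eigenval M l" "(M - l *\<^sub>M mat 1) ** X = 0"
  shows "X = 0"
proof -
  have "X *v w = 0" for w
  proof (rule ccontr)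
    assume "X *v w \<noteq> 0"
    have "((M - l *\<^sub>M mat 1) ** X) *v w = 0"
      by (simp add: assms(2))
    then have "M *v (X *v w) - (l *\<^sub>M mat 1) *v (X *v w) = 0"
      by (simp add: matrix_vector_mul_assoc mm.diff_left matrix_vector_mult_diff_rdistrib)
    moreover have "(l *\<^sub>M mat 1) *v y = l *s y" for y :: "complex^'r"
      by (simp add: matrix_vector_mult_def cscale_def mat_def vec_eq_iff if_distrib if_distribR cong: if_cong)
    ultimately show False
      using assms(1) \<open>X *v w \<noteq> 0\<close> by (auto simp: eigenval_def)
  qed
  then show ?thesis
    by (simp add: matrix_eq)
qed

text \<open>The polynomial is split into linear factors over the complex numbers. A root that is an
  eigenvalue goes into the list; any other root is cancelled. Only eigenvalues remain, the numbers
  about which positive stability says something.\<close>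

lemma ex_shift_product:
  fixes M W :: "complex^'r^'r"
  assumes "p \<noteq> 0" "poly_mat p M ** W = 0"
  shows "\<exists>ls. (\<forall>l\<in>set ls. eigenval M l) \<and> shift_product M ls W = 0"
  using assms
proof (induction "degree p" arbitrary: p W)
  case 0
  then obtain c where "p = [:c:]"
    by (metis degree_eq_zeroE)
  with 0 have "W = 0"
    by (simp add: cscale_mult_left) (metis norm_cscale norm_eq_zero mult_eq_0_iff)
  then show ?case
    by (intro exI [of _ "[]"]) simp
next
  case (Suc n)
  then obtain l where "poly p l = 0"
    using fundamental_theorem_of_algebra [of p] constant_degree [of p] by auto
  then obtain q where q: "p = [:- l, 1:] * q"
    by (metis poly_eq_0_iff_dvd dvdE)
  with Suc.prems(1) have q0: "q \<noteq> 0" by auto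
  have deg: "n = degree q"
    using Suc.hyps(2) q0 unfolding q by (subst (asm) degree_mult_eq) auto
  show ?case
  proof (cases "eigenval M l")
    case True
    have "poly_mat q M ** ((M - l *\<^sub>M mat 1) ** W) = poly_mat p M ** W"
      by (simp only: q poly_mat_linear_factor)
        (simp add: matrix_simps cscale_mult_left cscale_mult_right matrix_mul_assoc poly_mat_commute)
    then have "poly_mat q M ** ((M - l *\<^sub>M mat 1) ** W) = 0"
      using Suc.prems by simp
    from Suc.hyps(1) [OF deg q0 this] obtain ls where
      "\<forall>l\<in>set ls. eigenval M l" "shift_product M ls ((M - l *\<^sub>M mat 1) ** W) = 0" by blast
    with True show ?thesis
      by (intro exI [of _ "l # ls"]) simp
  next
    case False
    have "(M - l *\<^sub>M mat 1) ** (poly_mat q M ** W) = 0"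
      using Suc.prems(2) unfolding q poly_mat_linear_factor by (simp only: matrix_mul_assoc)
    from shift_cancel [OF False this] show ?thesis
      by (rule Suc.hyps(1) [OF deg q0])
  qed
qed

lemma positive_stable_mexp_decay:
  fixes M :: "complex^'r^'r"
  assumes "positive_stable M"
  obtains C \<delta> where "C > 0" "\<delta> > 0" "\<And>s. s \<ge> 0 \<Longrightarrow> norm (mexp ((- s) *\<^sub>R M)) \<le> C * exp (- \<delta> * s)"
proof -
  obtain p where "p \<noteq> 0" "poly_mat p M = 0"
    by (rule ex_annihilating_poly)
  then obtain ls where ls: "\<forall>l\<in>set ls. eigenval M l" "shift_product M ls (mat 1) = 0"
    using ex_shift_product [of p M "mat 1"] by auto
  have "\<exists>\<delta>>0. \<forall>l\<in>set ls. \<delta> < Re l"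
    using ls(1)
  proof (induction ls)
    case (Cons l ls)
    then obtain \<delta> where "\<delta> > 0" "\<forall>l\<in>set ls. \<delta> < Re l" by auto
    moreover have "Re l > 0"
      using Cons.prems assms by (auto simp: eigenval_def positive_stable_def)
    ultimately show ?case
      \<comment> \<open>Halving keeps the inequality for l strict.\<close>
      by (intro exI [of _ "min \<delta> (Re l / 2)"]) auto
  qed (auto intro: exI [of _ 1])
  then obtain \<delta> where \<delta>: "\<delta> > 0" "\<forall>l\<in>set ls. \<delta> < Re l" by blast
  obtain C where C: "\<And>s. s \<ge> 0 \<Longrightarrow> norm (mexp ((- s) *\<^sub>R M)) \<le> C * exp (- \<delta> * s)"
    using mexp_decay_shift_product [OF \<delta>(2) ls(2)] by auto
  show thesis
  proof (rule that [of "max C 1" \<delta>])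
    fix s :: real assume "s \<ge> 0"
    from C [OF this] show "norm (mexp ((- s) *\<^sub>R M)) \<le> max C 1 * exp (- \<delta> * s)"
      by (rule order_trans) simp
  qed (use \<delta> in auto)
qed

text \<open>The eigenvalues of A have modulus at most \<open>norm A\<close>, so m beyond that norm
  suffices. The shift is an integer for the sake of the later binomial coefficients.\<close>

lemma positive_stable_shift:
  fixes A :: "complex^'r^'r"
  obtains m :: nat where "positive_stable (real (m + 1) *\<^sub>R mat 1 - A)"
proof -
  obtain m :: nat where m: "norm A < real m"
    using reals_Archimedean2 by blast
  have "Re l > 0" if "v \<noteq> 0" "(real (m + 1) *\<^sub>R mat 1 - A) *v v = l *s v" for l v
  proof -
    have "(real (m + 1) *\<^sub>R mat 1) *v v = of_nat (m + 1) *s v"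
      by (simp add: matrix_vector_mult_def mat_def vec_eq_iff scaleR_conv_of_real [where 'a = complex]
          if_distrib if_distribR distrib_right cong: if_cong)
    then have Av: "A *v v = (of_nat (m + 1) - l) *s v"
      using that(2) by (simp add: matrix_vector_mult_diff_rdistrib vec_eq_iff algebra_simps)
    \<comment> \<open>All columns equal v: the eigenvector equation becomes a matrix equation, and
      the submultiplicative norm bounds the eigenvalue.\<close>
    define X where "X = (\<chi> i (j :: 'r). v $ i)"
    have "A ** X = (of_nat (m + 1) - l) *\<^sub>M X"
      using Av by (simp add: X_def matrix_matrix_mult_def matrix_vector_mult_def cscale_def vec_eq_iff algebra_simps)
    then have "norm (of_nat (m + 1) - l) * norm X \<le> norm A * norm X"
      by (metis norm_cscale norm_matrix_mult_le)
    moreover have "X \<noteq> 0"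
      using that(1) by (auto simp: X_def vec_eq_iff)
    ultimately have "norm (of_nat (m + 1) - l) < real m"
      using m by simp
    then have "Re (of_nat (m + 1) - l) < real m"
      using complex_Re_le_cmod order_le_less_trans by blast
    then show ?thesis by simp
  qed
  then show thesis
    by (intro that) (auto simp: positive_stable_def)
qed

subsection \<open>Matrix powers and moments of the beta kernel\<close>

lemma mpowr_one [simp]: "mpowr 1 M = mat 1"
  by (simp add: mpowr_def)

lemma mpowr_zero_exponent [simp]: "mpowr t 0 = mat 1"
  by (simp add: mpowr_def)

lemma mpowr_add_scalar:
  assumes "t > 0"
  shows "mpowr t (M + c *\<^sub>R mat 1) = (t powr c) *\<^sub>R mpowr t M"
proof -
  have "mexp (ln t *\<^sub>R M + (ln t * c) *\<^sub>R mat 1) = mexp (ln t *\<^sub>R M) ** mexp ((ln t * c) *\<^sub>R mat 1)"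
    by (rule mexp_add) (simp add: matrix_simps)
  then show ?thesis
    using assms by (simp add: mpowr_def scaleR_add_right mexp_scaleR_mat matrix_simps powr_def mult.commute)
qed

lemma mpowr_eq_scaleR_minus_one: "t > 0 \<Longrightarrow> mpowr t M = t *\<^sub>R mpowr t (M - mat 1)"
  using mpowr_add_scalar [of t "M - mat 1" 1] by simp

lemma mpowr_commute:
  assumes "M ** N = N ** M"
  shows "mpowr t M ** N = N ** mpowr t M"
  unfolding mpowr_def by (rule mexp_commute) (simp add: matrix_simps assms)

lemma mpowr_mpowr_commute:
  assumes "M ** N = N ** M"
  shows "mpowr s M ** mpowr t N = mpowr t N ** mpowr s M"
proof -
  have "mpowr t N ** M = M ** mpowr t N"
    by (rule mpowr_commute) (simp add: assms)
  then show ?thesis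
    by (intro mpowr_commute) simp
qed

lemma mpowr_left_invertible: "mexp (- (ln t *\<^sub>R M)) ** mpowr t M = mat 1"
  unfolding mpowr_def by (rule mexp_minus)

lemma has_vector_derivative_mpowr:
  assumes "t > 0"
  shows "((\<lambda>t. mpowr t M) has_vector_derivative mpowr t (M - mat 1) ** M) (at t)"
proof -
  have "(ln has_vector_derivative (1 / t)) (at t)"
    using DERIV_ln_divide [OF assms] by (simp add: has_real_derivative_iff_has_vector_derivative)
  from vector_diff_chain_at [OF this has_vector_derivative_mexp [of M "ln t" UNIV]]
  have "((\<lambda>t. mpowr t M) has_vector_derivative (1 / t) *\<^sub>R (mpowr t M ** M)) (at t)"
    by (simp add: mpowr_def [abs_def] o_def)
  then show ?thesis
    by (rule has_vector_derivative_eq_rhs)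
      (use assms in \<open>simp add: mpowr_eq_scaleR_minus_one [of t M] matrix_simps\<close>)
qed

lemma has_vector_derivative_mpowr_one_minus:
  assumes "t < 1"
  shows "((\<lambda>t. mpowr (1 - t) M) has_vector_derivative - (mpowr (1 - t) (M - mat 1) ** M)) (at t)"
proof -
  have "((\<lambda>t. 1 - t) has_vector_derivative (- 1)) (at t)"
    by (auto intro!: derivative_eq_intros)
  from vector_diff_chain_at [OF this, of "\<lambda>t. mpowr t M"] show ?thesis
    using has_vector_derivative_mpowr [of "1 - t" M] assms by (simp add: o_def)
qed

lemma continuous_on_mpowr: "continuous_on {0<..<1} (\<lambda>t. mpowr t M)"
  by (intro continuous_at_imp_continuous_on ballI)
    (rule has_vector_derivative_continuous, rule has_vector_derivative_mpowr, simp)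

lemma continuous_on_mpowr_one_minus: "continuous_on {0<..<1} (\<lambda>t. mpowr (1 - t) M)"
  by (intro continuous_at_imp_continuous_on ballI)
    (rule has_vector_derivative_continuous, rule has_vector_derivative_mpowr_one_minus, simp)

text \<open>Under t = exp (- s) the exponential decay at rate \<eta> turns into the power t^\<eta>;
  the missing factor t lowers the exponent by 1.\<close>

lemma positive_stable_mpowr_bound:
  assumes "positive_stable P"
  obtains C \<eta> where "C > 0" "\<eta> > 0"
    "\<And>t. 0 < t \<Longrightarrow> t \<le> 1 \<Longrightarrow> norm (mpowr t (P - mat 1)) \<le> C * t powr (\<eta> - 1)"
proof -
  obtain C \<eta> where C: "C > 0" "\<eta> > 0" "\<And>s. s \<ge> 0 \<Longrightarrow> norm (mexp ((- s) *\<^sub>R P)) \<le> C * exp (- \<eta> * s)"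
    using positive_stable_mexp_decay [OF assms] by blast
  show thesis
  proof (rule that [OF C(1,2)])
    fix t :: real assume t: "0 < t" "t \<le> 1"
    have "t * norm (mpowr t (P - mat 1)) = norm (mpowr t P)"
      using t by (simp add: mpowr_eq_scaleR_minus_one [of t P])
    also have "\<dots> \<le> C * t powr \<eta>"
      using C(3) [of "- ln t"] t by (simp add: mpowr_def powr_def)
    also have "\<dots> = t * (C * t powr (\<eta> - 1))"
      using t by (simp add: powr_diff)
    finally show "norm (mpowr t (P - mat 1)) \<le> C * t powr (\<eta> - 1)"
      using t by simp
  qed
qed

section \<open>The beta kernel and its integrability\<close>

definition beta_kernel :: "complex^'r^'r \<Rightarrow> complex^'r^'r \<Rightarrow> real \<Rightarrow> complex^'r^'r" where
  "beta_kernel P Q t = mpowr t (P - mat 1) ** mpowr (1 - t) (Q - mat 1)"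

lemma continuous_on_beta_kernel: "continuous_on {0<..<1} (beta_kernel P Q)"
  unfolding beta_kernel_def
  by (intro mm.continuous_on continuous_on_mpowr continuous_on_mpowr_one_minus)

lemma beta_kernel_bound:
  assumes "positive_stable P" "positive_stable Q"
  obtains C a b where "C > 0" "a > 0" "b > 0"
    "\<And>t. 0 < t \<Longrightarrow> t < 1 \<Longrightarrow> norm (beta_kernel P Q t) \<le> C * (t powr (a - 1) * (1 - t) powr (b - 1))"
proof -
  obtain C a where C: "C > 0" "a > 0"
    "\<And>t. 0 < t \<Longrightarrow> t \<le> 1 \<Longrightarrow> norm (mpowr t (P - mat 1)) \<le> C * t powr (a - 1)"
    using positive_stable_mpowr_bound [OF assms(1)] by blast
  obtain D b where D: "D > 0" "b > 0"
    "\<And>t. 0 < t \<Longrightarrow> t \<le> 1 \<Longrightarrow> norm (mpowr t (Q - mat 1)) \<le> D * t powr (b - 1)"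
    using positive_stable_mpowr_bound [OF assms(2)] by blast
  show thesis
  proof (rule that [of "C * D" a b])
    fix t :: real assume t: "0 < t" "t < 1"
    have "norm (beta_kernel P Q t) \<le> norm (mpowr t (P - mat 1)) * norm (mpowr (1 - t) (Q - mat 1))"
      unfolding beta_kernel_def by (rule norm_matrix_mult_le)
    also have "\<dots> \<le> (C * t powr (a - 1)) * (D * (1 - t) powr (b - 1))"
      using t C D by (intro mult_mono) auto
    finally show "norm (beta_kernel P Q t) \<le> C * D * (t powr (a - 1) * (1 - t) powr (b - 1))"
      by (simp add: mult_ac)
  qed (use C D in auto)
qed

lemma set_integrable_powr_beta:
  assumes "a > 0" "b > (0::real)"
  shows "set_integrable lborel {0<..<1} (\<lambda>t. t powr (a - 1) * (1 - t) powr (b - 1))"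
  by (rule set_integrable_subset [OF integrable_Beta [OF assms]]) auto

lemma set_borel_measurable_continuous_unit:
  fixes f :: "real \<Rightarrow> 'a::{real_normed_vector, second_countable_topology}"
  assumes "continuous_on {0<..<1} f"
  shows "set_borel_measurable lborel {0<..<1} f"
  using borel_measurable_continuous_on_indicator [OF _ assms]
  by (simp add: set_borel_measurable_def)

lemma set_integrable_beta_kernel:
  assumes "positive_stable P" "positive_stable Q"
  shows "set_integrable lborel {0<..<1} (beta_kernel P Q)"
proof -
  obtain C a b where C: "C > 0" "a > 0" "b > 0"
    "\<And>t. 0 < t \<Longrightarrow> t < 1 \<Longrightarrow> norm (beta_kernel P Q t) \<le> C * (t powr (a - 1) * (1 - t) powr (b - 1))"
    using beta_kernel_bound [OF assms] by blast
  show ?thesis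
  proof (rule set_integrable_bound)
    show "set_integrable lborel {0<..<1} (\<lambda>t. C * (t powr (a - 1) * (1 - t) powr (b - 1)))"
      by (intro set_integrable_mult_right set_integrable_powr_beta C)
    show "AE t in lborel. t \<in> {0<..<1} \<longrightarrow> norm (beta_kernel P Q t)
        \<le> norm (C * (t powr (a - 1) * (1 - t) powr (b - 1)))"
      using C by (intro AE_I2) (auto simp: abs_mult)
  qed (intro set_borel_measurable_continuous_unit continuous_on_beta_kernel)
qed

lemma set_integrable_power_scaleR:
  fixes g :: "real \<Rightarrow> 'a::{banach, second_countable_topology}"
  assumes "set_integrable lborel {0<..<1} g"
  shows "set_integrable lborel {0<..<1} (\<lambda>t. t ^ n *\<^sub>R g t)"
proof (rule set_integrable_bound [OF assms])
  have "(\<lambda>t. t ^ n *\<^sub>R (indicat_real {0<..<1} t *\<^sub>R g t)) \<in> borel_measurable lborel"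
    using assms [unfolded set_integrable_def, THEN borel_measurable_integrable]
    by (rule borel_measurable_scaleR [rotated]) simp
  then show "set_borel_measurable lborel {0<..<1} (\<lambda>t. t ^ n *\<^sub>R g t)"
    by (simp add: set_borel_measurable_def mult.commute)
  show "AE t in lborel. t \<in> {0<..<1} \<longrightarrow> norm (t ^ n *\<^sub>R g t) \<le> norm (g t)"
    by (intro AE_I2) (auto simp: mult_left_le_one_le power_le_one)
qed

lemma set_integral_bounded_linear:
  assumes "bounded_linear T" "set_integrable M S f"
  shows "(LINT t:S|M. T (f t)) = T (LINT t:S|M. f t)"
    and "set_integrable M S (\<lambda>t. T (f t))"
proof -
  interpret T: bounded_linear T by fact
  show "(LINT t:S|M. T (f t)) = T (LINT t:S|M. f t)"
    using integral_bounded_linear [OF assms(1), of M "\<lambda>t. indicat_real S t *\<^sub>R f t"] assms(2)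
    by (simp add: set_lebesgue_integral_def set_integrable_def T.scaleR)
  show "set_integrable M S (\<lambda>t. T (f t))"
    using integrable_bounded_linear [OF assms(1), of M "\<lambda>t. indicat_real S t *\<^sub>R f t"] assms(2)
    by (simp add: set_integrable_def T.scaleR)
qed

text \<open>The boundary values enter as one-sided limits, because \<open>mpowr\<close> is
  meaningless at 0.\<close>

lemma set_integral_FTC_unit:
  fixes f F :: "real \<Rightarrow> 'a::euclidean_space"
  assumes "\<And>t. 0 < t \<Longrightarrow> t < 1 \<Longrightarrow> (F has_vector_derivative f t) (at t)"
    and "continuous_on {0<..<1} f" "set_integrable lborel {0<..<1} f"
    and "(F \<longlongrightarrow> a) (at_right 0)" "(F \<longlongrightarrow> b) (at_left 1)"
  shows "(LINT t:{0<..<1}|lborel. f t) = b - a"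
proof -
  have eint: "einterval (ereal 0) (ereal 1) = {0<..<1}"
    by (auto simp: einterval_def)
  have "(LBINT t=ereal 0..ereal 1. f t) = b - a"
  proof (rule interval_integral_FTC_integrable)
    show "isCont f x" if "ereal 0 < ereal x" "ereal x < ereal 1" for x
      using assms(2) that by (simp add: continuous_on_eq_continuous_at)
  qed (use assms in \<open>auto simp: eint ereal_tendsto_simps1\<close>)
  then show ?thesis
    by (simp add: interval_lebesgue_integral_def eint)
qed

text \<open>This is the beta integral with parameters P + n I and Q; in moment form n enters only
  through a scalar weight on a fixed kernel.\<close>

definition beta_moment :: "complex^'r^'r \<Rightarrow> complex^'r^'r \<Rightarrow> nat \<Rightarrow> complex^'r^'r" where
  "beta_moment P Q n = (LINT t:{0<..<1}|lborel. t ^ n *\<^sub>R beta_kernel P Q t)"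

text \<open>Integration by parts: t^(P + n I) (1 - t)^Q vanishes at both ends, and its derivative is
  the difference of the two integrands. For n = 0 this is the classical B(P, Q) P = B(P + I, Q) (P +
  Q).\<close>

lemma beta_moment_Suc:
  assumes P: "positive_stable P" and Q: "positive_stable Q" and "P ** Q = Q ** P"
  shows "beta_moment P Q n ** (P + real n *\<^sub>R mat 1)
    = beta_moment P Q (Suc n) ** (P + Q + real n *\<^sub>R mat 1)"
proof -
  let ?k = "beta_kernel P Q"
  define F where "F t = t ^ n *\<^sub>R (mpowr t P ** mpowr (1 - t) Q)" for t
  define f where "f t = (t ^ n *\<^sub>R ?k t) ** (P + real n *\<^sub>R mat 1)
    - (t ^ Suc n *\<^sub>R ?k t) ** (P + Q + real n *\<^sub>R mat 1)" for t
  have F_eq: "F t = (t ^ n * t * (1 - t)) *\<^sub>R ?k t" if "0 < t" "t < 1" for t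
    using that mpowr_eq_scaleR_minus_one [of t P] mpowr_eq_scaleR_minus_one [of "1 - t" Q]
    by (simp add: F_def beta_kernel_def matrix_simps mult_ac)
  have int: "set_integrable lborel {0<..<1} (\<lambda>t. (t ^ n *\<^sub>R ?k t) ** X)" for n X
    by (intro set_integral_bounded_linear(2) [OF mm.bounded_linear_left]
        set_integrable_power_scaleR set_integrable_beta_kernel P Q)
  have "(LINT t:{0<..<1}|lborel. f t) = 0 - 0"
  proof (rule set_integral_FTC_unit)
    fix t :: real assume t: "0 < t" "t < 1"
    have comm: "mpowr (1 - t) Q ** P = P ** mpowr (1 - t) Q"
      by (rule mpowr_commute) (simp add: assms)
    have "(F has_vector_derivative (t ^ n *\<^sub>R (mpowr t P ** - (mpowr (1 - t) (Q - mat 1) ** Q)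
        + mpowr t (P - mat 1) ** P ** mpowr (1 - t) Q)
        + (real n * t ^ (n - 1)) *\<^sub>R (mpowr t P ** mpowr (1 - t) Q))) (at t)"
      unfolding F_def
      by (intro has_vector_derivative_scaleR has_vector_derivative_matrix_mult
          has_vector_derivative_mpowr has_vector_derivative_mpowr_one_minus t)
        (auto intro!: derivative_eq_intros)
    also have "mpowr t (P - mat 1) ** P ** mpowr (1 - t) Q = (1 - t) *\<^sub>R (?k t ** P)"
      using t mpowr_eq_scaleR_minus_one [of "1 - t" Q] comm
      by (simp add: beta_kernel_def matrix_simps flip: matrix_mul_assoc)
    also have "mpowr t P ** - (mpowr (1 - t) (Q - mat 1) ** Q) = - (t *\<^sub>R (?k t ** Q))"
      using t mpowr_eq_scaleR_minus_one [of t P]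
      by (simp add: beta_kernel_def matrix_simps matrix_mul_assoc)
    \<comment> \<open>For n = 0 the truncated exponent n - 1 is harmless, since the factor
      \<open>real n\<close> is zero.\<close>
    also have "(real n * t ^ (n - 1)) *\<^sub>R (mpowr t P ** mpowr (1 - t) Q) = (real n * t ^ n * (1 - t)) *\<^sub>R ?k t"
      using t mpowr_eq_scaleR_minus_one [of t P] mpowr_eq_scaleR_minus_one [of "1 - t" Q]
      by (cases n) (simp_all add: beta_kernel_def matrix_simps mult_ac)
    also have "t ^ n *\<^sub>R (- (t *\<^sub>R (?k t ** Q)) + (1 - t) *\<^sub>R (?k t ** P)) + (real n * t ^ n * (1 - t)) *\<^sub>R ?k t = f t"
      by (simp add: f_def matrix_simps algebra_simps)
    finally show "(F has_vector_derivative f t) (at t)" .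
  next
    show "continuous_on {0<..<1} f"
      unfolding f_def by (intro continuous_intros mm.continuous_on continuous_on_beta_kernel)
    show "set_integrable lborel {0<..<1} f"
      unfolding f_def by (intro set_integral_diff int)
    obtain C a b where C: "C > 0" "a > 0" "b > 0"
      "\<And>t. 0 < t \<Longrightarrow> t < 1 \<Longrightarrow> norm (?k t) \<le> C * (t powr (a - 1) * (1 - t) powr (b - 1))"
      using beta_kernel_bound [OF P Q] by blast
    \<comment> \<open>Compared with the kernel, both exponents gain 1 and become positive, so F
      tends to 0 at both ends although the kernel may be singular there.\<close>
    have Fb: "norm (F t) \<le> C * (t powr a * (1 - t) powr b)" if t: "0 < t" "t < 1" for t
    proof -
      have "norm (F t) \<le> 1 * (t * (1 - t) * norm (?k t))"
        unfolding F_eq [OF t] using t by (simp add: mult_left_le_one_le power_le_one mult.assoc)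
      also have "\<dots> \<le> t * (1 - t) * (C * (t powr (a - 1) * (1 - t) powr (b - 1)))"
        using t C(4) [OF t] by (simp add: mult_left_mono)
      also have "\<dots> = C * (t powr a * (1 - t) powr b)"
        using t by (simp add: powr_diff)
      finally show ?thesis .
    qed
    have "\<forall>\<^sub>F t in at_right 0. t \<in> {0<..<(1::real)}"
      by (rule eventually_at_right_real) simp
    then have "\<forall>\<^sub>F t in at_right 0. norm (F t) \<le> C * (t powr a * (1 - t) powr b)"
      by eventually_elim (use Fb in auto)
    moreover have "((\<lambda>t. C * (t powr a * (1 - t) powr b)) \<longlongrightarrow> 0) (at_right (0::real))"
      by (rule tendsto_eq_rhs [where x = "C * (0 powr a * (1 - 0) powr b)"], intro tendsto_intros tendsto_powr')
        (use C in \<open>auto simp: eventually_at_filter\<close>)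
    ultimately show "(F \<longlongrightarrow> 0) (at_right 0)"
      by (rule Lim_null_comparison)
    have "\<forall>\<^sub>F t in at_left 1. t \<in> {0<..<(1::real)}"
      by (rule eventually_at_left_real) simp
    then have "\<forall>\<^sub>F t in at_left 1. norm (F t) \<le> C * (t powr a * (1 - t) powr b)"
      by eventually_elim (use Fb in auto)
    moreover have "((\<lambda>t. C * (t powr a * (1 - t) powr b)) \<longlongrightarrow> 0) (at_left (1::real))"
      by (rule tendsto_eq_rhs [where x = "C * (1 powr a * (1 - 1) powr b)"], intro tendsto_intros tendsto_powr')
        (use C in \<open>auto simp: eventually_at_filter\<close>)
    ultimately show "(F \<longlongrightarrow> 0) (at_left 1)"
      by (rule Lim_null_comparison)
  qed
  then have "(LINT t:{0<..<1}|lborel. (t ^ n *\<^sub>R ?k t) ** (P + real n *\<^sub>R mat 1))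
      = (LINT t:{0<..<1}|lborel. (t ^ Suc n *\<^sub>R ?k t) ** (P + Q + real n *\<^sub>R mat 1))"
    unfolding f_def by (subst (asm) set_integral_diff(2) [OF int int]) simp
  then show ?thesis
    unfolding beta_moment_def
    by (simp only: set_integral_bounded_linear(1) [OF mm.bounded_linear_left
          set_integrable_power_scaleR [OF set_integrable_beta_kernel [OF P Q]]])
qed

section \<open>Pochhammer symbols as moments\<close>

lemma mpoch_commute: "M ** N = N ** M \<Longrightarrow> mpoch M n ** N = N ** mpoch M n"
proof (induction n)
  case (Suc n)
  have "(M + real n *\<^sub>R mat 1) ** N = N ** (M + real n *\<^sub>R mat 1)"
    by (simp add: matrix_simps Suc.prems)
  then show ?case
    using Suc by (simp flip: matrix_mul_assoc) (simp add: matrix_mul_assoc)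
qed simp

lemma positive_stable_one: "positive_stable (mat 1 :: complex^'r^'r)"
  unfolding positive_stable_def
proof safe
  fix l and v :: "complex^'r"
  assume "v \<noteq> 0" "mat 1 *v v = l *s v"
  then obtain i where "v $ i \<noteq> 0" "v $ i = l * v $ i"
    by (auto simp: vec_eq_iff)
  then show "Re l > 0" by simp
qed

text \<open>The kernel is (1 - t)^(B - I), and - (1 - t)^B is a primitive of its product with
  B.\<close>

lemma beta_moment_one_0:
  assumes B: "positive_stable B"
  shows "beta_moment (mat 1) B 0 ** B = mat 1"
proof -
  let ?k = "beta_kernel (mat 1) B"
  have int: "set_integrable lborel {0<..<1} ?k"
    by (intro set_integrable_beta_kernel positive_stable_one B)
  have "(LINT t:{0<..<1}|lborel. ?k t ** B) = 0 - (- mat 1)"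
  proof (rule set_integral_FTC_unit)
    show "((\<lambda>t. - mpowr (1 - t) B) has_vector_derivative ?k t ** B) (at t)" if "0 < t" "t < 1" for t
      by (rule has_vector_derivative_eq_rhs,
          rule has_vector_derivative_minus [OF has_vector_derivative_mpowr_one_minus [OF that(2)]])
        (simp add: beta_kernel_def)
    show "continuous_on {0<..<1} (\<lambda>t. ?k t ** B)"
      by (intro mm.continuous_on continuous_on_beta_kernel continuous_on_const)
    show "set_integrable lborel {0<..<1} (\<lambda>t. ?k t ** B)"
      by (rule set_integral_bounded_linear(2) [OF mm.bounded_linear_left int])
    have "isCont (\<lambda>t. - mpowr (1 - t) B) 0"
      by (intro continuous_intros has_vector_derivative_continuous
          [OF has_vector_derivative_mpowr_one_minus]) simp
    then show "((\<lambda>t. - mpowr (1 - t) B) \<longlongrightarrow> - mat 1) (at_right 0)"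
      by (simp add: isCont_def filterlim_at_split)
    obtain C \<eta> where C: "C > 0" "\<eta> > 0"
      "\<And>t. 0 < t \<Longrightarrow> t \<le> 1 \<Longrightarrow> norm (mpowr t (B - mat 1)) \<le> C * t powr (\<eta> - 1)"
      using positive_stable_mpowr_bound [OF B] by blast
    have bound: "norm (- mpowr (1 - t) B) \<le> C * (1 - t) powr \<eta>" if "0 < t" "t < 1" for t
    proof -
      have "norm (- mpowr (1 - t) B) = (1 - t) * norm (mpowr (1 - t) (B - mat 1))"
        using that mpowr_eq_scaleR_minus_one [of "1 - t" B] by simp
      also have "\<dots> \<le> (1 - t) * (C * (1 - t) powr (\<eta> - 1))"
        using that C by (intro mult_left_mono) auto
      also have "\<dots> = C * (1 - t) powr \<eta>"
        using that by (simp add: powr_diff)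
      finally show ?thesis .
    qed
    have "\<forall>\<^sub>F t in at_left 1. t \<in> {0<..<(1::real)}"
      by (rule eventually_at_left_real) simp
    then have "\<forall>\<^sub>F t in at_left 1. norm (- mpowr (1 - t) B) \<le> C * (1 - t) powr \<eta>"
      by eventually_elim (use bound in auto)
    moreover have "((\<lambda>t. C * (1 - t) powr \<eta>) \<longlongrightarrow> 0) (at_left (1::real))"
      by (rule tendsto_eq_rhs [where x = "C * (1 - 1) powr \<eta>"], intro tendsto_intros tendsto_powr')
        (use C in \<open>auto simp: eventually_at_filter\<close>)
    ultimately show "((\<lambda>t. - mpowr (1 - t) B) \<longlongrightarrow> 0) (at_left 1)"
      by (rule Lim_null_comparison)
  qed
  then show ?thesis
    by (simp add: beta_moment_def set_integral_bounded_linear(1) [OF mm.bounded_linear_left int])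
qed

text \<open>The matrix version of B(n + 1, b) = n! / (b)_(n+1), by induction along the moment
  recursion.\<close>

lemma beta_moment_one:
  assumes B: "positive_stable B"
  shows "beta_moment (mat 1) B n ** mpoch B (Suc n) = fact n *\<^sub>R mat 1"
proof (induction n)
  case 0
  then show ?case
    by (simp add: beta_moment_one_0 [OF B])
next
  case (Suc n)
  let ?M = "beta_moment (mat 1) B" and ?X = "mat 1 + B + real n *\<^sub>R mat 1"
  have rec: "?M (Suc n) ** ?X = real (Suc n) *\<^sub>R ?M n"
    using beta_moment_Suc [OF positive_stable_one B, of n] by (simp add: matrix_simps scaleR_add_left)
  have "B + real (Suc n) *\<^sub>R mat 1 = ?X"
    by (simp add: scaleR_add_left)
  then have "?M (Suc n) ** mpoch B (Suc (Suc n)) = ?M (Suc n) ** (mpoch B (Suc n) ** ?X)"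
    by (simp only: mpoch.simps(2) [of B "Suc n"])
  \<comment> \<open>The last Pochhammer factor is exactly the right factor of the recursion; it is
    moved to the front to meet the moment.\<close>
  also have "mpoch B (Suc n) ** ?X = ?X ** mpoch B (Suc n)"
    by (rule mpoch_commute) (simp add: matrix_simps)
  also have "?M (Suc n) ** (?X ** mpoch B (Suc n)) = real (Suc n) *\<^sub>R (?M n ** mpoch B (Suc n))"
    by (simp only: matrix_mul_assoc rec mm.scaleR_left)
  also have "\<dots> = fact (Suc n) *\<^sub>R mat 1"
    by (simp only: Suc.IH scaleR_scaleR fact_Suc of_nat_mult of_nat_fact)
  finally show ?case .
qed

text \<open>The moment is an explicit witness for the inverse and so proves invertibility as
  well.\<close>

lemma matrix_inv_mpoch_Suc:
  assumes "positive_stable B"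
  shows "matrix_inv (mpoch B (Suc n)) = beta_moment (mat 1) B n /\<^sub>R fact n"
proof -
  have "(beta_moment (mat 1) B n /\<^sub>R fact n) ** mpoch B (Suc n) = mat 1"
    unfolding mm.scaleR_left beta_moment_one [OF assms] by simp
  then have "mpoch B (Suc n) ** (beta_moment (mat 1) B n /\<^sub>R fact n) = mat 1"
    by (rule matrix_invD(1))
  then show ?thesis
    by (rule matrix_invD(2))
qed

text \<open>With A + Q scalar, the right factor of the recursion is the number c + n, so the
  quotient of Pochhammer symbols builds up without any matrix being divided.\<close>

lemma beta_moment_mpoch:
  assumes "positive_stable A" "positive_stable Q" "A + Q = c *\<^sub>R mat 1"
  shows "beta_moment A Q 0 ** mpoch A n = pochhammer c n *\<^sub>R beta_moment A Q n"
proof (induction n)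
  case (Suc n)
  have Q: "Q = c *\<^sub>R mat 1 - A"
    using assms(3) by (simp add: algebra_simps)
  have "beta_moment A Q 0 ** mpoch A (Suc n) = pochhammer c n *\<^sub>R (beta_moment A Q n ** (A + real n *\<^sub>R mat 1))"
    by (simp add: matrix_mul_assoc Suc.IH mm.scaleR_left)
  also have "beta_moment A Q n ** (A + real n *\<^sub>R mat 1) = beta_moment A Q (Suc n) ** (A + Q + real n *\<^sub>R mat 1)"
    by (rule beta_moment_Suc [OF assms(1,2)]) (simp add: Q matrix_simps)
  also have "\<dots> = (c + real n) *\<^sub>R beta_moment A Q (Suc n)"
    by (simp add: assms(3) matrix_simps scaleR_add_left)
  finally show ?case
    by (simp add: pochhammer_Suc)
qed simp

text \<open>Since h is merely integrable, it is tested against continuous functions on the closed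
  interval: replacing one by a polynomial within e costs at most e times the L1 norm of h. A bump
  times h is then an admissible test function.\<close>

lemma zero_moments_imp_zero:
  fixes h :: "real \<Rightarrow> real"
  assumes cont: "continuous_on {0<..<1} h" and int: "set_integrable lborel {0<..<1} h"
    and mom: "\<And>n. (LINT t:{0<..<1}|lborel. t ^ n * h t) = 0"
    and c: "c \<in> {0<..<1}"
  shows "h c = 0"
proof -
  let ?S = "{0<..<1::real}"
  have intp: "set_integrable lborel ?S (\<lambda>t. g t * h t)" if g: "continuous_on {0..1} g" for g :: "real \<Rightarrow> real"
  proof -
    have "bounded (g ` {0..1})"
      by (intro compact_imp_bounded compact_continuous_image g) simp
    then obtain K where K: "\<And>t. t \<in> {0..1} \<Longrightarrow> \<bar>g t\<bar> \<le> K"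
      unfolding bounded_iff real_norm_def by (metis imageI)
    show ?thesis
    proof (rule set_integrable_bound)
      show "set_integrable lborel ?S (\<lambda>t. K * h t)"
        using int by simp
      show "set_borel_measurable lborel ?S (\<lambda>t. g t * h t)"
        by (intro set_borel_measurable_continuous_unit continuous_on_mult cont
            continuous_on_subset [OF g]) auto
      show "AE t in lborel. t \<in> ?S \<longrightarrow> norm (g t * h t) \<le> norm (K * h t)"
        using K by (intro AE_I2) (force simp: abs_mult intro!: mult_right_mono intro: order_trans [OF _ abs_ge_self])
    qed
  qed
  \<comment> \<open>Bernstein polynomials are combinations of these products, which the induction
    reduces to pure moments.\<close>
  have mom2: "(LINT t:?S|lborel. t ^ i * (1 - t) ^ j * h t) = 0" for i j
  proof (induction j arbitrary: i)
    case (Suc j)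
    have "(LINT t:?S|lborel. t ^ i * (1 - t) ^ Suc j * h t)
        = (LINT t:?S|lborel. t ^ i * (1 - t) ^ j * h t - t ^ Suc i * (1 - t) ^ j * h t)"
      by (simp add: algebra_simps)
    also have "\<dots> = 0"
      by (subst set_integral_diff(2)) (auto intro!: intp continuous_intros simp: Suc.IH simp del: power_Suc)
    finally show ?case .
  qed (simp add: mom)
  have bern: "(LINT t:?S|lborel. (\<Sum>k\<le>n. a k * Bernstein n k t) * h t) = 0" for a n
  proof -
    have "(LINT t:?S|lborel. (\<Sum>k\<le>n. a k * Bernstein n k t) * h t)
        = (LINT t:?S|lborel. \<Sum>k\<le>n. (a k * real (n choose k)) * (t ^ k * (1 - t) ^ (n - k) * h t))"
      by (simp add: Bernstein_def sum_distrib_left mult_ac)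
    also have "\<dots> = (\<Sum>k\<le>n. LINT t:?S|lborel. (a k * real (n choose k)) * (t ^ k * (1 - t) ^ (n - k) * h t))"
      unfolding set_lebesgue_integral_def scaleR_sum_right
    proof (rule Bochner_Integration.integral_sum)
      fix k
      have "set_integrable lborel ?S (\<lambda>t. a k * real (n choose k) * (t ^ k * (1 - t) ^ (n - k) * h t))"
        by (intro set_integrable_mult_right impI intp continuous_intros)
      then show "integrable lborel
          (\<lambda>t. indicat_real ?S t *\<^sub>R (a k * real (n choose k) * (t ^ k * (1 - t) ^ (n - k) * h t)))"
        by (simp add: set_integrable_def)
    qed
    also have "\<dots> = 0"
      by (simp add: mom2)
    finally show ?thesis .
  qed
  have zero: "(LINT t:?S|lborel. g t * h t) = 0" if g: "continuous_on {0..1} g" for g :: "real \<Rightarrow> real"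
  proof -
    define J where "J = (LINT t:?S|lborel. \<bar>h t\<bar>)"
    have J0: "J \<ge> 0"
      unfolding J_def set_lebesgue_integral_def by (rule Bochner_Integration.integral_nonneg) simp
    have "\<bar>LINT t:?S|lborel. g t * h t\<bar> \<le> e * J" if e: "e > 0" for e
    proof -
      obtain N where N: "\<And>n x. N \<le> n \<Longrightarrow> x \<in> {0..1} \<Longrightarrow> \<bar>g x - (\<Sum>k\<le>n. g (k / n) * Bernstein n k x)\<bar> < e"
        using Bernstein_Weierstrass [OF g e] by blast
      define p where "p x = (\<Sum>k\<le>N. g (k / N) * Bernstein N k x)" for x
      have p: "continuous_on {0..1} p"
        unfolding p_def Bernstein_def by (intro continuous_intros)
      have "(LINT t:?S|lborel. g t * h t) = (LINT t:?S|lborel. g t * h t) - (LINT t:?S|lborel. p t * h t)"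
        using bern [where n = N and a = "\<lambda>k. g (k / N)"] by (simp add: p_def)
      also have "\<dots> = (LINT t:?S|lborel. (g t - p t) * h t)"
        unfolding left_diff_distrib by (rule set_integral_diff(2) [symmetric]) (intro intp g p)+
      finally have eq: "(LINT t:?S|lborel. g t * h t) = (LINT t:?S|lborel. (g t - p t) * h t)" .
      have "\<bar>LINT t:?S|lborel. (g t - p t) * h t\<bar> \<le> (LINT t:?S|lborel. \<bar>(g t - p t) * h t\<bar>)"
        using integral_norm_bound [of lborel "\<lambda>t. indicat_real ?S t *\<^sub>R ((g t - p t) * h t)"]
        by (simp add: set_lebesgue_integral_def abs_mult)
      also have "\<dots> \<le> (LINT t:?S|lborel. e * \<bar>h t\<bar>)"
      proof (rule set_integral_mono)
        show "set_integrable lborel ?S (\<lambda>t. \<bar>(g t - p t) * h t\<bar>)"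
          by (intro set_integrable_abs intp continuous_on_diff g p)
        show "set_integrable lborel ?S (\<lambda>t. e * \<bar>h t\<bar>)"
          by (intro set_integrable_mult_right set_integrable_abs int)
        show "\<bar>(g t - p t) * h t\<bar> \<le> e * \<bar>h t\<bar>" if "t \<in> ?S" for t
          using N [of N t] that unfolding abs_mult p_def by (intro mult_right_mono) auto
      qed
      also have "\<dots> = e * J"
        by (simp add: J_def)
      finally show ?thesis
        by (simp add: eq)
    qed
    note bound = this
    show ?thesis
    proof (rule ccontr)
      assume "(LINT t:?S|lborel. g t * h t) \<noteq> 0"
      then have pos: "0 < \<bar>LINT t:?S|lborel. g t * h t\<bar>" (is "0 < ?d") by simp
      \<comment> \<open>The tolerance is chosen with J + 1 rather than J so that J = 0 is
        covered.\<close>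
      have "?d \<le> ?d / (2 * (J + 1)) * J"
        using J0 pos by (intro bound divide_pos_pos) auto
      also have "\<dots> = ?d * (J / (2 * (J + 1)))"
        by simp
      also have "\<dots> < ?d * 1"
        using J0 by (intro mult_strict_left_mono pos) (simp add: divide_simps)
      finally show False by simp
    qed
  qed
  define a b where "a = c / 2" and "b = (1 + c) / 2"
  have ab: "0 < a" "a < c" "c < b" "b < 1"
    using c by (auto simp: a_def b_def)
  \<comment> \<open>A bump supported on [a, b] times h. Clamping the argument to [a, b] keeps g
    continuous up to 0 and 1, where h may blow up; the bump hides the change, so g h is the bump
    times the square of h.\<close>
  define g where "g t = max 0 ((t - a) * (b - t)) * h (max a (min b t))" for t
  have "continuous_on {0..1} (\<lambda>t. h (max a (min b t)))"
  proof (rule continuous_on_compose2 [OF cont])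
    show "continuous_on {0..1} (\<lambda>t. max a (min b t))"
      by (intro continuous_intros)
  qed (use ab in auto)
  then have g: "continuous_on {0..1} g"
    unfolding g_def by (intro continuous_intros)
  have nonneg: "0 \<le> g t * h t" and out: "g t * h t = max 0 ((t - a) * (b - t)) * (h t)\<^sup>2" for t
  proof -
    show "g t * h t = max 0 ((t - a) * (b - t)) * (h t)\<^sup>2"
    proof (cases "a \<le> t \<and> t \<le> b")
      case False
      then have "(t - a) * (b - t) \<le> 0"
        using ab by (auto simp: mult_le_0_iff)
      then show ?thesis by (simp add: g_def)
    qed (simp add: g_def power2_eq_square)
    then show "0 \<le> g t * h t" by simp
  qed
  have sub: "{a..b} \<subseteq> ?S"
    using ab by auto
  have contgh: "continuous_on {a..b} (\<lambda>t. g t * h t)"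
    by (intro continuous_on_mult continuous_on_subset [OF g] continuous_on_subset [OF cont]) (use ab in auto)
  have "integral {a..b} (\<lambda>t. g t * h t) \<le> integral ?S (\<lambda>t. g t * h t)"
  proof (rule integral_subset_le [OF sub])
    show "(\<lambda>t. g t * h t) integrable_on {a..b}"
      by (intro integrable_continuous_real contgh)
    show "(\<lambda>t. g t * h t) integrable_on ?S"
      using set_borel_integral_eq_integral(1) [OF intp [OF g]] .
  qed (use nonneg in auto)
  also have "\<dots> = 0"
    using set_borel_integral_eq_integral(2) [OF intp [OF g]] zero [OF g] by simp
  finally have "integral {a..b} (\<lambda>t. g t * h t) = 0"
    using integral_nonneg [OF integrable_continuous_real [OF contgh]] nonneg by force
  then have "((\<lambda>t. g t * h t) has_integral 0) (cbox a b)"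
    using integrable_integral [OF integrable_continuous_real [OF contgh]] by simp
  from has_integral_0_cbox_imp_0 [OF _ _ this, of c] have "g c * h c = 0"
    using contgh nonneg ab by auto
  then show ?thesis
    using ab unfolding out by auto
qed

lemma left_mult_mpowr_eq_0: "X ** mpowr t M = 0 \<Longrightarrow> X = 0"
proof -
  assume 0: "X ** mpowr t M = 0"
  have "mpowr t M ** mexp (- (ln t *\<^sub>R M)) = mat 1"
    using mpowr_left_invertible matrix_invD(1) by blast
  then have "X = X ** mpowr t M ** mexp (- (ln t *\<^sub>R M))"
    by (simp flip: matrix_mul_assoc)
  then show "X = 0"
    by (simp add: 0)
qed

text \<open>A vector in the left kernel of the zeroth moment annihilates all moments of the kernel,
  hence, the polynomials being dense, the kernel itself, whose values are invertible.\<close>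

lemma beta_moment_0_invertible:
  fixes A Q :: "complex^'r^'r"
  assumes A: "positive_stable A" and Q: "positive_stable Q" and AQ: "A + Q = c *\<^sub>R mat 1" and "c > 0"
  obtains Z where "Z ** beta_moment A Q 0 = mat 1"
proof -
  let ?k = "beta_kernel A Q"
  have ker: "X = 0" if X: "X ** beta_moment A Q 0 = 0" for X :: "complex^'r^'r"
  proof -
    have "X ** beta_moment A Q n = 0" for n
    proof -
      have "X ** (beta_moment A Q 0 ** mpoch A n) = 0"
        by (simp add: matrix_mul_assoc X)
      moreover have "pochhammer c n > 0"
        using \<open>c > 0\<close> by (rule pochhammer_pos)
      ultimately show ?thesis
        by (simp add: beta_moment_mpoch [OF A Q AQ] mm.scaleR_right)
    qed
    \<comment> \<open>Pairing with U reduces to a real function whose value at 1/2 is the squared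
      norm of U; any interior point would serve.\<close>
    define U where "U = X ** ?k (1/2)"
    have lin: "bounded_linear (\<lambda>Y. (X ** Y) \<bullet> U)"
      using bounded_linear_compose [OF bounded_linear_inner_left mm.bounded_linear_right] .
    have int: "set_integrable lborel {0<..<1} ?k"
      by (intro set_integrable_beta_kernel A Q)
    have "(X ** ?k (1/2)) \<bullet> U = 0"
    proof (rule zero_moments_imp_zero [where h = "\<lambda>t. (X ** ?k t) \<bullet> U"])
      show "continuous_on {0<..<1} (\<lambda>t. (X ** ?k t) \<bullet> U)"
        by (intro continuous_intros mm.continuous_on continuous_on_beta_kernel)
      show "set_integrable lborel {0<..<1} (\<lambda>t. (X ** ?k t) \<bullet> U)"
        by (rule set_integral_bounded_linear(2) [OF lin int])
      show "(LINT t:{0<..<1}|lborel. t ^ n * ((X ** ?k t) \<bullet> U)) = 0" for n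
        using set_integral_bounded_linear(1) [OF lin set_integrable_power_scaleR [OF int, of n]]
          \<open>X ** beta_moment A Q n = 0\<close>
        by (simp add: beta_moment_def mm.scaleR_right)
    qed simp
    then have "U = 0"
      by (simp add: U_def)
    then have "X ** mpowr (1/2) (A - mat 1) ** mpowr (1 - 1/2) (Q - mat 1) = 0"
      unfolding U_def beta_kernel_def by (simp only: matrix_mul_assoc)
    then show "X = 0"
      by (rule left_mult_mpowr_eq_0 [OF left_mult_mpowr_eq_0])
  qed
  have "x = 0" if x: "x v* beta_moment A Q 0 = 0" for x
  proof -
    \<comment> \<open>All rows equal x, so the statement on matrices covers a single row
      vector.\<close>
    define X where "X = (\<chi> (i :: 'r) j. x $ j)"
    have "X ** beta_moment A Q 0 = 0"
      using x by (simp add: X_def matrix_matrix_mult_def vector_matrix_mult_def vec_eq_iff mult.commute)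
    then have "X = 0"
      by (rule ker)
    then show ?thesis
      by (simp add: X_def vec_eq_iff)
  qed
  then have "\<exists>W. W ** transpose (beta_moment A Q 0) = mat 1"
    by (simp add: matrix_left_invertible_ker)
  then show thesis
    using that by (metis matrix_left_right_inverse left_invertible_transpose)
qed

subsection \<open>Power series under the integral\<close>

text \<open>As t^n is at most 1, the terms are dominated by \<open>norm (g t) * norm (D n)\<close>,
  so absolute summability of D alone justifies the exchange. This serves the series in z as well as
  both moment representations.\<close>

lemma
  fixes g :: "real \<Rightarrow> complex^'r^'r"
  assumes g: "set_integrable lborel {0<..<1} g" and D: "summable (\<lambda>n. norm (D n))"
  shows set_integrable_power_series: "set_integrable lborel {0<..<1} (\<lambda>t. g t ** (\<Sum>n. t ^ n *\<^sub>R D n))"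
    and sums_power_series_integral: "(\<lambda>n. (LINT t:{0<..<1}|lborel. t ^ n *\<^sub>R g t) ** D n) sums
      (LINT t:{0<..<1}|lborel. g t ** (\<Sum>n. t ^ n *\<^sub>R D n))"
proof -
  let ?S = "{0<..<1::real}"
  define f where "f n t = indicat_real ?S t *\<^sub>R ((t ^ n *\<^sub>R g t) ** D n)" for n t
  have int: "set_integrable lborel ?S (\<lambda>t. (t ^ n *\<^sub>R g t) ** D n)" for n
    by (intro set_integral_bounded_linear(2) [OF mm.bounded_linear_left] set_integrable_power_scaleR g)
  have intf: "integrable lborel (f n)" for n
    using int [of n] by (simp add: set_integrable_def f_def [abs_def])
  have fn: "norm (f n t) \<le> norm (indicat_real ?S t *\<^sub>R g t) * norm (D n)" for n t
  proof (cases "t \<in> ?S")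
    case True
    have "norm (f n t) \<le> norm (t ^ n *\<^sub>R g t) * norm (D n)"
      using True norm_matrix_mult_le [of "t ^ n *\<^sub>R g t" "D n"] by (simp add: f_def)
    also have "\<dots> \<le> norm (g t) * norm (D n)"
      using True by (intro mult_right_mono) (auto simp: mult_left_le_one_le power_le_one)
    finally show ?thesis
      using True by simp
  qed (simp add: f_def)
  have sumf: "summable (\<lambda>n. norm (f n t))" for t
    by (rule summable_comparison_test' [OF summable_mult [OF D]]) (use fn in simp)
  have sumint: "summable (\<lambda>n. LINT t|lborel. norm (f n t))"
  proof (rule summable_comparison_test')
    show "summable (\<lambda>n. (LINT t|lborel. norm (indicat_real ?S t *\<^sub>R g t)) * norm (D n))"
      by (rule summable_mult [OF D])
    have gi: "integrable lborel (\<lambda>t. norm (indicat_real ?S t *\<^sub>R g t))"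
      using g unfolding set_integrable_def by (rule integrable_norm)
    show "norm (LINT t|lborel. norm (f n t)) \<le> (LINT t|lborel. norm (indicat_real ?S t *\<^sub>R g t)) * norm (D n)"
      for n
    proof -
      have "(LINT t|lborel. norm (f n t)) \<le> (LINT t|lborel. norm (indicat_real ?S t *\<^sub>R g t) * norm (D n))"
        by (intro integral_mono integrable_norm intf integrable_mult_left gi fn)
      then show ?thesis by simp
    qed
  qed
  have eq: "(\<Sum>n. f n t) = indicat_real ?S t *\<^sub>R (g t ** (\<Sum>n. t ^ n *\<^sub>R D n))" for t
  proof (cases "t \<in> ?S")
    case True
    have "summable (\<lambda>n. t ^ n *\<^sub>R D n)"
      by (rule summable_comparison_test' [OF D])
        (use True in \<open>auto simp: mult_left_le_one_le power_le_one\<close>)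
    from bounded_linear.suminf [OF mm.bounded_linear_right this, of "g t"] show ?thesis
      using True by (simp add: f_def matrix_simps)
  qed (simp add: f_def)
  show "set_integrable lborel ?S (\<lambda>t. g t ** (\<Sum>n. t ^ n *\<^sub>R D n))"
    using integrable_suminf [OF intf _ sumint] sumf by (simp add: set_integrable_def eq)
  have "(\<lambda>n. integral\<^sup>L lborel (f n)) sums (LINT t|lborel. (\<Sum>n. f n t))"
    by (rule sums_integral [OF intf _ sumint]) (use sumf in simp)
  moreover have "integral\<^sup>L lborel (f n) = (LINT t:?S|lborel. t ^ n *\<^sub>R g t) ** D n" for n
    using set_integral_bounded_linear(1) [OF mm.bounded_linear_left set_integrable_power_scaleR [OF g], of n "D n"]
    by (simp add: f_def [abs_def] set_lebesgue_integral_def)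
  ultimately show "(\<lambda>n. (LINT t:?S|lborel. t ^ n *\<^sub>R g t) ** D n) sums
      (LINT t:?S|lborel. g t ** (\<Sum>n. t ^ n *\<^sub>R D n))"
    by (simp add: eq set_lebesgue_integral_def)
qed

text \<open>Because (n choose k) / n! = 1 / (k! (n - k)!), this is the exponential series shifted by
  k; the first k terms vanish.\<close>

lemma sums_binomial_mexp:
  "(\<lambda>n. (real (n choose k) / fact n) *\<^sub>R mpow W n) sums ((1 / fact k) *\<^sub>R (mpow W k ** mexp W))"
proof -
  have "(\<lambda>n. (1 / fact k) *\<^sub>R (mpow W k ** (mpow W n /\<^sub>R fact n))) sums ((1 / fact k) *\<^sub>R (mpow W k ** mexp W))"
    by (intro bounded_linear.sums [OF bounded_linear_scaleR_right]
        bounded_linear.sums [OF mm.bounded_linear_right] mexp_sums)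
  moreover have "(1 / fact k) *\<^sub>R (mpow W k ** (mpow W n /\<^sub>R fact n))
      = (real ((n + k) choose k) / fact (n + k)) *\<^sub>R mpow W (n + k)" for n
  proof -
    have "mpow W k ** mpow W n = mpow W (n + k)"
      by (metis add.commute mpow_add)
    moreover have "real ((n + k) choose k) / fact (n + k) = 1 / fact k * (1 / fact n)"
      using binomial_fact [of k "n + k", where 'a = real] by simp
    ultimately show ?thesis
      by (simp only: matrix_simps scaleR_scaleR inverse_eq_divide)
  qed
  moreover have "(\<Sum>n<k. (real (n choose k) / fact n) *\<^sub>R mpow W n) = 0"
    by (intro sum.neutral) simp
  ultimately show ?thesis
    using sums_iff_shift [of "\<lambda>n. (real (n choose k) / fact n) *\<^sub>R mpow W n" k] by simp
qed

text \<open>By Vandermonde's identity, the polynomial weight \<open>n \<mapsto> (n + N choose m)\<close> only multiplies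
  the exponential by a polynomial.\<close>

lemma sums_binomial_shift_mexp:
  "(\<lambda>n. (real ((n + N) choose m) / fact n) *\<^sub>R mpow W n) sums
    (\<Sum>k\<le>m. (real (N choose (m - k)) / fact k) *\<^sub>R (mpow W k ** mexp W))"
proof -
  have "(\<lambda>n. \<Sum>k\<le>m. real (N choose (m - k)) *\<^sub>R ((real (n choose k) / fact n) *\<^sub>R mpow W n)) sums
      (\<Sum>k\<le>m. real (N choose (m - k)) *\<^sub>R ((1 / fact k) *\<^sub>R (mpow W k ** mexp W)))"
    by (intro sums_sum bounded_linear.sums [OF bounded_linear_scaleR_right] sums_binomial_mexp)
  moreover have "(\<Sum>k\<le>m. real (N choose (m - k)) *\<^sub>R ((real (n choose k) / fact n) *\<^sub>R mpow W n))
      = (real ((n + N) choose m) / fact n) *\<^sub>R mpow W n" for n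
    by (simp add: vandermonde [of n N m, symmetric] scaleR_sum_left [symmetric] sum_divide_distrib [symmetric]
        sum_distrib_right [symmetric] mult.commute)
  ultimately show ?thesis
    by simp
qed

section \<open>Decay of the weighted exponential\<close>

lemma power_le_fact_exp:
  assumes "(y::real) \<ge> 0"
  shows "y ^ k \<le> fact k * exp y"
proof -
  have "(\<Sum>n\<in>{k}. y ^ n /\<^sub>R fact n) \<le> (\<Sum>n. y ^ n /\<^sub>R fact n)"
    by (intro sum_le_suminf summable_exp_generic) (use assms in auto)
  then show ?thesis
    by (simp add: exp_def field_simps)
qed

lemma positive_stable_binomial_exp_decay:
  fixes Y :: "complex^'r^'r"
  assumes "positive_stable Y"
  obtains C \<delta> where "C \<ge> 0" "\<delta> > 0"
    "\<And>x. x \<ge> 0 \<Longrightarrow> norm (\<Sum>n. (real ((n + N) choose m) / fact n) *\<^sub>R mpow ((- x) *\<^sub>R Y) n) \<le> C * exp (- \<delta> * x)"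
proof -
  obtain C \<delta> where C: "C > 0" "\<delta> > 0"
    "\<And>x. x \<ge> 0 \<Longrightarrow> norm (mexp ((- x) *\<^sub>R Y)) \<le> C * exp (- \<delta> * x)"
    using positive_stable_mexp_decay [OF assms] by blast
  define K where "K k = real (N choose (m - k)) * ((2 / \<delta>) ^ k * norm (mpow Y k) * C)" for k
  have term_bound: "norm ((real (N choose (m - k)) / fact k) *\<^sub>R (mpow ((- x) *\<^sub>R Y) k ** mexp ((- x) *\<^sub>R Y)))
      \<le> K k * exp (- (\<delta> / 2) * x)" if x: "x \<ge> 0" for k x
  proof -
    \<comment> \<open>Half of the decay rate is spent on absorbing the factor x^k.\<close>
    have "x ^ k = (2 / \<delta>) ^ k * (\<delta> / 2 * x) ^ k"
      using C by (simp add: power_mult_distrib field_simps)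
    also have "\<dots> \<le> (2 / \<delta>) ^ k * (fact k * exp (\<delta> / 2 * x))"
      using C x by (intro mult_left_mono power_le_fact_exp) auto
    finally have xk: "x ^ k \<le> (2 / \<delta>) ^ k * (fact k * exp (\<delta> / 2 * x))" .
    have "norm (mpow ((- x) *\<^sub>R Y) k ** mexp ((- x) *\<^sub>R Y)) \<le> norm (mpow ((- x) *\<^sub>R Y) k) * norm (mexp ((- x) *\<^sub>R Y))"
      by (rule norm_matrix_mult_le)
    also have "norm (mpow ((- x) *\<^sub>R Y) k) = x ^ k * norm (mpow Y k)"
      using x by (simp only: mpow_scaleR norm_scaleR power_abs) simp
    also have "x ^ k * norm (mpow Y k) * norm (mexp ((- x) *\<^sub>R Y))
        \<le> ((2 / \<delta>) ^ k * (fact k * exp (\<delta> / 2 * x))) * norm (mpow Y k) * (C * exp (- \<delta> * x))"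
      using x C by (intro mult_mono mult_right_mono xk C(3)) auto
    also have "\<dots> = fact k * ((2 / \<delta>) ^ k * norm (mpow Y k) * C) * (exp (\<delta> / 2 * x) * exp (- \<delta> * x))"
      by (simp only: mult_ac)
    also have "exp (\<delta> / 2 * x) * exp (- \<delta> * x) = exp (- (\<delta> / 2) * x)"
      by (simp flip: exp_add)
    finally have "norm (mpow ((- x) *\<^sub>R Y) k ** mexp ((- x) *\<^sub>R Y))
      \<le> fact k * ((2 / \<delta>) ^ k * norm (mpow Y k) * C) * exp (- (\<delta> / 2) * x)" .
    from mult_left_mono [OF this, of "real (N choose (m - k)) / fact k"]
    show ?thesis
      by (simp add: K_def mult_ac)
  qed
  show thesis
  proof (rule that [of "\<Sum>k\<le>m. K k" "\<delta> / 2"])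
    show "(\<Sum>k\<le>m. K k) \<ge> 0"
      unfolding K_def using C by (intro sum_nonneg mult_nonneg_nonneg) auto
    fix x :: real assume x: "x \<ge> 0"
    have "norm (\<Sum>n. (real ((n + N) choose m) / fact n) *\<^sub>R mpow ((- x) *\<^sub>R Y) n)
      = norm (\<Sum>k\<le>m. (real (N choose (m - k)) / fact k) *\<^sub>R (mpow ((- x) *\<^sub>R Y) k ** mexp ((- x) *\<^sub>R Y)))"
      by (simp only: sums_unique [OF sums_binomial_shift_mexp, symmetric])
    also have "\<dots> \<le> (\<Sum>k\<le>m. K k * exp (- (\<delta> / 2) * x))"
      by (intro sum_norm_le term_bound x)
    finally show "norm (\<Sum>n. (real ((n + N) choose m) / fact n) *\<^sub>R mpow ((- x) *\<^sub>R Y) n)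
        \<le> (\<Sum>k\<le>m. K k) * exp (- (\<delta> / 2) * x)"
      by (simp add: sum_distrib_right)
  qed (use C in auto)
qed

lemma summable_norm_binomial_mpow:
  fixes W :: "complex^'r^'r"
  shows "summable (\<lambda>n. norm ((real ((n + N) choose m) / fact n) *\<^sub>R mpow W n))"
proof (rule summable_comparison_test')
  show "summable (\<lambda>n. norm (mat 1 :: complex^'r^'r) * 2 ^ N * ((2 * norm W) ^ n /\<^sub>R fact n))"
    by (intro summable_mult summable_exp_generic)
  show "norm (norm ((real ((n + N) choose m) / fact n) *\<^sub>R mpow W n))
      \<le> norm (mat 1 :: complex^'r^'r) * 2 ^ N * ((2 * norm W) ^ n /\<^sub>R fact n)" for n
  proof -
    have "real ((n + N) choose m) \<le> 2 ^ (n + N)"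
      using binomial_le_pow2 [of "n + N" m] by (metis of_nat_le_iff of_nat_numeral of_nat_power)
    then have "real ((n + N) choose m) * norm (mpow W n)
        \<le> 2 ^ (n + N) * (norm (mat 1 :: complex^'r^'r) * norm W ^ n)"
      by (intro mult_mono norm_mpow_le) auto
    then show ?thesis
      by (simp add: field_simps power_add power_mult_distrib)
  qed
qed

text \<open>For t up to 1/2 the weight is bounded and the exponential factor has mass at most 1 /
  \<delta>; beyond 1/2 the weight may be singular, but x exp (- \<delta> x t) is bounded uniformly
  in x. The prefactor x stems from the extra W in \<open>hyp_coeff\<close>.\<close>

lemma exp_beta_integral_bounded:
  assumes "\<eta> > 0" "\<delta> > (0::real)"
  obtains K where "\<And>x. x \<ge> 0 \<Longrightarrow> set_integrable lborel {0<..<1} (\<lambda>t. (1 - t) powr (\<eta> - 1) * (x * exp (- \<delta> * x * t)))"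
    "\<And>x. x \<ge> 0 \<Longrightarrow> (LINT t:{0<..<1}|lborel. (1 - t) powr (\<eta> - 1) * (x * exp (- \<delta> * x * t))) \<le> K"
proof -
  let ?S = "{0<..<1::real}"
  \<comment> \<open>Bounds the weight on (0, 1/2] for either sign of the exponent.\<close>
  define c where "c = max 1 ((1 / 2) powr (\<eta> - 1) :: real)"
  define I where "I = (LINT t:?S|lborel. (1 - t) powr (\<eta> - 1))"
  have int1: "set_integrable lborel ?S (\<lambda>t. (1 - t) powr (\<eta> - 1))"
  proof -
    have "set_integrable lborel ?S (\<lambda>t. t powr (1 - 1) * (1 - t) powr (\<eta> - 1))"
      by (rule set_integrable_powr_beta) (use assms in auto)
    then show ?thesis
      by (rule iffD1 [OF set_integrable_cong, rotated -1]) auto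
  qed
  have int2: "set_integrable lborel ?S (\<lambda>t. x * exp (- \<delta> * x * t))" for x
    by (rule set_integrable_subset [of _ "{0..1}"], rule borel_integrable_atLeastAtMost') (auto intro!: continuous_intros)
  have bound: "(1 - t) powr (\<eta> - 1) * (x * exp (- \<delta> * x * t))
      \<le> c * (x * exp (- \<delta> * x * t)) + 2 / \<delta> * (1 - t) powr (\<eta> - 1)" if x: "x \<ge> 0" and t: "t \<in> ?S" for x t
  proof (cases "t \<le> 1 / 2")
    case True
    have "(1 - t) powr (\<eta> - 1) \<le> c"
    proof (cases "\<eta> \<ge> 1")
      case True
      then have "(1 - t) powr (\<eta> - 1) \<le> 1"
        using t by (intro powr_le1) auto
      then show ?thesis by (simp add: c_def)
    next
      case False
      then have "(1 - t) powr (\<eta> - 1) \<le> (1 / 2) powr (\<eta> - 1)"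
        using \<open>t \<le> 1 / 2\<close> t by (intro powr_mono2') auto
      then show ?thesis by (simp add: c_def)
    qed
    then have "(1 - t) powr (\<eta> - 1) * (x * exp (- \<delta> * x * t)) \<le> c * (x * exp (- \<delta> * x * t))"
      using x by (intro mult_right_mono) auto
    then show ?thesis
      using assms by (simp add: add_increasing2)
  next
    case False
    have "exp (- \<delta> * x * t) \<le> exp (- (\<delta> / 2 * x))"
      using False x assms mult_left_mono [of "1/2" t "\<delta> * x"] by simp
    then have "x * exp (- \<delta> * x * t) \<le> x * exp (- (\<delta> / 2 * x))"
      using x by (rule mult_left_mono)
    \<comment> \<open>This is y exp (- y) \<le> 1 at y = \<delta> x / 2.\<close>
    also have "\<dots> \<le> 2 / \<delta>"
      using power_le_fact_exp [of "\<delta> / 2 * x" 1] assms x by (simp add: exp_minus field_simps)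
    finally have "x * exp (- \<delta> * x * t) \<le> 2 / \<delta>" .
    then have "(1 - t) powr (\<eta> - 1) * (x * exp (- \<delta> * x * t)) \<le> (1 - t) powr (\<eta> - 1) * (2 / \<delta>)"
      by (rule mult_left_mono) simp
    moreover have "0 \<le> c * (x * exp (- \<delta> * x * t))"
      using x by (simp add: c_def)
    ultimately show ?thesis
      by (simp add: mult.commute)
  qed
  have int3: "set_integrable lborel ?S (\<lambda>t. c * (x * exp (- \<delta> * x * t)) + 2 / \<delta> * (1 - t) powr (\<eta> - 1))" for x
    by (intro set_integral_add set_integrable_mult_right int1 int2)
  have int: "set_integrable lborel ?S (\<lambda>t. (1 - t) powr (\<eta> - 1) * (x * exp (- \<delta> * x * t)))" if "x \<ge> 0" for x
  proof (rule set_integrable_bound [OF int3])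
    show "set_borel_measurable lborel ?S (\<lambda>t. (1 - t) powr (\<eta> - 1) * (x * exp (- \<delta> * x * t)))"
      unfolding set_borel_measurable_def by measurable
    show "AE t in lborel. t \<in> ?S \<longrightarrow> norm ((1 - t) powr (\<eta> - 1) * (x * exp (- \<delta> * x * t)))
        \<le> norm (c * (x * exp (- \<delta> * x * t)) + 2 / \<delta> * (1 - t) powr (\<eta> - 1))"
    proof (intro AE_I2 impI)
      fix t assume "t \<in> ?S"
      have "0 \<le> (1 - t) powr (\<eta> - 1) * (x * exp (- \<delta> * x * t))"
        using that by simp
      with bound [OF that \<open>t \<in> ?S\<close>] show "norm ((1 - t) powr (\<eta> - 1) * (x * exp (- \<delta> * x * t)))
        \<le> norm (c * (x * exp (- \<delta> * x * t)) + 2 / \<delta> * (1 - t) powr (\<eta> - 1))"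
        by simp
    qed
  qed
  have exp_le: "(LINT t:?S|lborel. x * exp (- \<delta> * x * t)) \<le> 1 / \<delta>" for x
  proof -
    define F where "F t = - exp (- \<delta> * x * t) / \<delta>" for t
    have F': "(F has_vector_derivative x * exp (- \<delta> * x * t)) (at t)" for t
      unfolding F_def has_real_derivative_iff_has_vector_derivative [symmetric]
      using assms by (auto intro!: derivative_eq_intros)
    then have "isCont F t" for t
      by (rule has_vector_derivative_continuous)
    then have "(F \<longlongrightarrow> F 0) (at_right 0)" "(F \<longlongrightarrow> F 1) (at_left 1)"
      by (simp_all add: isCont_def filterlim_at_split)
    then have "(LINT t:?S|lborel. x * exp (- \<delta> * x * t)) = F 1 - F 0"
      using F' int2 by (intro set_integral_FTC_unit [where F = F]) (auto intro!: continuous_intros)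
    also have "\<dots> \<le> 1 / \<delta>"
      using assms by (simp add: F_def)
    finally show ?thesis .
  qed
  show thesis
  proof (rule that [OF int])
    fix x :: real assume x: "x \<ge> 0"
    have "(LINT t:?S|lborel. (1 - t) powr (\<eta> - 1) * (x * exp (- \<delta> * x * t)))
        \<le> (LINT t:?S|lborel. c * (x * exp (- \<delta> * x * t)) + 2 / \<delta> * (1 - t) powr (\<eta> - 1))"
      by (intro set_integral_mono int int3 bound x)
    also have "\<dots> = c * (LINT t:?S|lborel. x * exp (- \<delta> * x * t)) + 2 / \<delta> * I"
      unfolding I_def set_integral_mult_right [symmetric]
      by (rule set_integral_add(2)) (intro set_integrable_mult_right impI int1 int2)+
    also have "\<dots> \<le> c * (1 / \<delta>) + 2 / \<delta> * I"
      by (intro add_right_mono mult_left_mono exp_le) (simp add: c_def)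
    finally show "(LINT t:?S|lborel. (1 - t) powr (\<eta> - 1) * (x * exp (- \<delta> * x * t))) \<le> c * (1 / \<delta>) + 2 / \<delta> * I" .
  qed
qed

subsection \<open>Boundedness of the confluent hypergeometric function\<close>

text \<open>No integrability of f is assumed: the integral of a nonintegrable function is 0 by
  convention, and the majorant is nonnegative.\<close>

lemma norm_set_integral_le:
  fixes f :: "real \<Rightarrow> 'a::{banach, second_countable_topology}"
  assumes "set_integrable M S g" "\<And>t. t \<in> S \<Longrightarrow> norm (f t) \<le> g t"
  shows "norm (LINT t:S|M. f t) \<le> (LINT t:S|M. g t)"
proof (cases "set_integrable M S f")
  case True
  have "norm (LINT t:S|M. f t) \<le> (LINT t|M. norm (indicat_real S t *\<^sub>R f t))"
    unfolding set_lebesgue_integral_def by (rule integral_norm_bound)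
  also have "\<dots> \<le> (LINT t:S|M. g t)"
    unfolding set_lebesgue_integral_def
    using True assms unfolding set_integrable_def
    by (intro integral_mono integrable_norm) (auto simp: indicator_def)
  finally show ?thesis .
next
  case False
  have "0 \<le> g t" if "t \<in> S" for t
    using assms(2) [OF that] norm_ge_zero [of "f t"] by linarith
  then have "0 \<le> (LINT t:S|M. g t)"
    unfolding set_lebesgue_integral_def
    by (intro Bochner_Integration.integral_nonneg) (simp add: indicator_def)
  with False show ?thesis
    by (simp add: set_lebesgue_integral_def set_integrable_def not_integrable_integral_eq)
qed

text \<open>The numbers \<open>(n + m + 1 choose m) / n!\<close> are what remains of the coefficients of the series of
  \<open>hyp_1F1\<close> after writing \<open>mpoch A (n + 1)\<close> and \<open>matrix_inv (mpoch B (n + 1))\<close> as the moments of beta kernels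
  with parameters \<open>(A, m + 1 - A)\<close> and \<open>(1, B)\<close>.\<close>

definition hyp_coeff :: "nat \<Rightarrow> complex^'r^'r \<Rightarrow> nat \<Rightarrow> complex^'r^'r" where
  "hyp_coeff m W n = (real ((n + (m + 1)) choose m) / fact n) *\<^sub>R mpow W n ** W"

lemma summable_norm_hyp_coeff: "summable (\<lambda>n. norm (hyp_coeff m W n))"
proof (rule summable_comparison_test')
  show "summable (\<lambda>n. norm ((real ((n + (m + 1)) choose m) / fact n) *\<^sub>R mpow W n) * norm W)"
    by (intro summable_mult2 summable_norm_binomial_mpow)
  show "norm (norm (hyp_coeff m W n)) \<le> norm ((real ((n + (m + 1)) choose m) / fact n) *\<^sub>R mpow W n) * norm W" for n
    unfolding hyp_coeff_def real_norm_def abs_norm_cancel by (rule norm_matrix_mult_le)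
qed

text \<open>The trailing W raises the exponent to n + 1, the index of the moment of A that
  accompanies this coefficient.\<close>

lemma hyp_coeff_scaleR: "hyp_coeff m (t *\<^sub>R W) n = t ^ Suc n *\<^sub>R hyp_coeff m W n"
  by (simp add: hyp_coeff_def mpow_scaleR matrix_simps mult_ac)

text \<open>Under the integral over the kernel (1 - t)^(B - I), the series becomes a binomially
  weighted exponential of - x t Y times - x Y. Its decay in x t and the factor x balance after
  integration, uniformly in x.\<close>

lemma inner_series_bounded:
  fixes B Y :: "complex^'r^'r"
  assumes B: "positive_stable B" and Y: "positive_stable Y"
  obtains K where "\<And>x. x \<ge> 0 \<Longrightarrow> norm (\<Sum>n. beta_moment (mat 1) B n ** hyp_coeff m ((- x) *\<^sub>R Y) n) \<le> K"
proof -
  let ?S = "{0<..<1::real}" and ?k = "beta_kernel (mat 1) B"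
  obtain C \<eta> where C: "C > 0" "\<eta> > 0"
    "\<And>t. 0 < t \<Longrightarrow> t \<le> 1 \<Longrightarrow> norm (mpowr t (B - mat 1)) \<le> C * t powr (\<eta> - 1)"
    using positive_stable_mpowr_bound [OF B] by blast
  obtain D \<delta> where D: "D \<ge> 0" "\<delta> > 0"
    "\<And>x. x \<ge> 0 \<Longrightarrow> norm (\<Sum>n. (real ((n + (m + 1)) choose m) / fact n) *\<^sub>R mpow ((- x) *\<^sub>R Y) n) \<le> D * exp (- \<delta> * x)"
    by (rule positive_stable_binomial_exp_decay [OF Y, where N = "m + 1" and m = m]) (rule that)
  obtain I where I: "\<And>x. x \<ge> 0 \<Longrightarrow> set_integrable lborel ?S (\<lambda>t. (1 - t) powr (\<eta> - 1) * (x * exp (- \<delta> * x * t)))"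
    "\<And>x. x \<ge> 0 \<Longrightarrow> (LINT t:?S|lborel. (1 - t) powr (\<eta> - 1) * (x * exp (- \<delta> * x * t))) \<le> I"
    by (rule exp_beta_integral_bounded [OF \<open>\<eta> > 0\<close> \<open>\<delta> > 0\<close>]) (rule that)
  show thesis
  proof (rule that [of "C * D * norm Y * I"])
    fix x :: real assume x: "x \<ge> 0"
    let ?W = "(- x) *\<^sub>R Y"
    have k: "set_integrable lborel ?S ?k"
      by (intro set_integrable_beta_kernel positive_stable_one B)
    have "(\<Sum>n. beta_moment (mat 1) B n ** hyp_coeff m ?W n)
        = (LINT t:?S|lborel. ?k t ** (\<Sum>n. t ^ n *\<^sub>R hyp_coeff m ?W n))"
      using sums_power_series_integral [OF k summable_norm_hyp_coeff]
      by (simp add: beta_moment_def sums_iff)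
    also have "norm \<dots> \<le> (LINT t:?S|lborel. (C * D * norm Y) * ((1 - t) powr (\<eta> - 1) * (x * exp (- \<delta> * x * t))))"
    proof (rule norm_set_integral_le)
      show "set_integrable lborel ?S (\<lambda>t. (C * D * norm Y) * ((1 - t) powr (\<eta> - 1) * (x * exp (- \<delta> * x * t))))"
        by (intro set_integrable_mult_right impI I x)
      fix t assume t: "t \<in> ?S"
      let ?E = "\<Sum>n. (real ((n + (m + 1)) choose m) / fact n) *\<^sub>R mpow ((- (x * t)) *\<^sub>R Y) n"
      have "summable (\<lambda>n. (real ((n + (m + 1)) choose m) / fact n) *\<^sub>R mpow ((- (x * t)) *\<^sub>R Y) n)"
        by (rule summable_norm_cancel [OF summable_norm_binomial_mpow])
      from bounded_linear.suminf [OF mm.bounded_linear_left this, of ?W]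
      moreover have "t ^ n *\<^sub>R hyp_coeff m ?W n
          = ((real ((n + (m + 1)) choose m) / fact n) *\<^sub>R mpow ((- (x * t)) *\<^sub>R Y) n) ** ?W" for n
      proof -
        have "mpow ((- (x * t)) *\<^sub>R Y) n = t ^ n *\<^sub>R mpow ?W n"
          using mpow_scaleR [of t ?W n] by (simp add: mult.commute)
        then show ?thesis
          by (simp only: hyp_coeff_def mm.scaleR_left scaleR_scaleR mult.commute)
      qed
      ultimately have E: "(\<Sum>n. t ^ n *\<^sub>R hyp_coeff m ?W n) = ?E ** ?W"
        by simp
      have "norm (?k t ** (\<Sum>n. t ^ n *\<^sub>R hyp_coeff m ?W n)) \<le> norm (?k t) * (norm ?E * norm ?W)"
        unfolding E by (intro order_trans [OF norm_matrix_mult_le] mult_left_mono norm_matrix_mult_le norm_ge_zero)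
      also have "\<dots> \<le> (C * (1 - t) powr (\<eta> - 1)) * ((D * exp (- \<delta> * (x * t))) * (x * norm Y))"
      proof (intro mult_mono)
        show "norm (?k t) \<le> C * (1 - t) powr (\<eta> - 1)"
          using C t by (simp add: beta_kernel_def)
        show "norm ?E \<le> D * exp (- \<delta> * (x * t))"
          using x t by (intro D) auto
        show "norm ?W \<le> x * norm Y"
          using x by simp
      qed (use x C D in auto)
      finally show "norm (?k t ** (\<Sum>n. t ^ n *\<^sub>R hyp_coeff m ?W n))
          \<le> (C * D * norm Y) * ((1 - t) powr (\<eta> - 1) * (x * exp (- \<delta> * x * t)))"
        by (simp only: mult_ac)
    qed
    also have "\<dots> \<le> C * D * norm Y * I"
      using I(2) [OF x] C D by (simp add: mult_left_mono)
    finally show "norm (\<Sum>n. beta_moment (mat 1) B n ** hyp_coeff m ?W n) \<le> C * D * norm Y * I" .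
  qed
qed

lemma norm_beta_moment_le:
  assumes "positive_stable P" "positive_stable Q"
  shows "norm (beta_moment P Q n) \<le> (LINT t:{0<..<1}|lborel. norm (beta_kernel P Q t))"
  unfolding beta_moment_def
proof (rule norm_set_integral_le)
  show "set_integrable lborel {0<..<1} (\<lambda>t. norm (beta_kernel P Q t))"
    using integrable_norm [OF set_integrable_beta_kernel [OF assms, unfolded set_integrable_def]]
    by (simp add: set_integrable_def abs_mult)
  show "norm (t ^ n *\<^sub>R beta_kernel P Q t) \<le> norm (beta_kernel P Q t)" if "t \<in> {0<..<1}" for t
    using that by (auto simp: mult_left_le_one_le power_le_one)
qed

text \<open>Apart from its first term, the function is Z times an integral over the kernel of (A, Q)
  of the inner series at t s. The inner series is bounded uniformly in its argument, so the L1 norm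
  of the kernel finishes the estimate.\<close>

lemma hyp_1F1_bounded:
  fixes A B Y :: "complex^'r^'r"
  assumes A: "positive_stable A" and B: "positive_stable B" and Y: "positive_stable Y"
  obtains K where "\<And>s. s \<ge> 0 \<Longrightarrow> norm (hyp_1F1 A B ((- s) *\<^sub>R Y)) \<le> K"
proof -
  let ?S = "{0<..<1::real}"
  obtain m :: nat where "positive_stable (real (m + 1) *\<^sub>R mat 1 - A)"
    by (rule positive_stable_shift)
  then obtain Q where Q: "positive_stable Q" and AQ: "A + Q = real (m + 1) *\<^sub>R mat 1"
    by (metis add_diff_cancel_left' diff_add_cancel add.commute)
  let ?k = "beta_kernel A Q"
  obtain Z where Z: "Z ** beta_moment A Q 0 = mat 1"
    by (rule beta_moment_0_invertible [OF A Q AQ]) auto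
  obtain K where K: "\<And>x. x \<ge> 0 \<Longrightarrow> norm (\<Sum>n. beta_moment (mat 1) B n ** hyp_coeff m ((- x) *\<^sub>R Y) n) \<le> K"
    by (rule inner_series_bounded [OF B Y, where m = m]) (rule that)
  have k: "set_integrable lborel ?S ?k"
    by (intro set_integrable_beta_kernel A Q)
  have norm_k: "set_integrable lborel ?S (\<lambda>t. norm (?k t))"
    using integrable_norm [OF k [unfolded set_integrable_def]]
    by (simp add: set_integrable_def abs_mult)
  define J where "J = (LINT t:?S|lborel. norm (?k t))"
  have term_Suc: "(mpoch A (Suc n) ** matrix_inv (mpoch B (Suc n)) ** mpow W (Suc n)) /\<^sub>R fact (Suc n)
      = Z ** (beta_moment A Q (Suc n) ** (beta_moment (mat 1) B n ** hyp_coeff m W n))" for W n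
  proof -
    have "mpoch A (Suc n) = Z ** (beta_moment A Q 0 ** mpoch A (Suc n))"
      by (simp only: matrix_mul_assoc Z matrix_mul_lid)
    also have "\<dots> = pochhammer (real (m + 1)) (Suc n) *\<^sub>R (Z ** beta_moment A Q (Suc n))"
      by (simp only: beta_moment_mpoch [OF A Q AQ] mm.scaleR_right)
    finally have a: "mpoch A (Suc n) = pochhammer (real (m + 1)) (Suc n) *\<^sub>R (Z ** beta_moment A Q (Suc n))" .
    have "fact (m + Suc n) = fact m * pochhammer (real (m + 1)) (Suc n)"
      using pochhammer_product [of m "m + Suc n" "1::real"] by (simp add: pochhammer_fact add.commute)
    moreover have "real ((n + (m + 1)) choose m) = fact (m + Suc n) / (fact m * fact (Suc n))"
      using binomial_fact [of m "n + (m + 1)", where 'a = real] by (simp add: add.commute)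
    ultimately have "real ((n + (m + 1)) choose m) = pochhammer (real (m + 1)) (Suc n) / fact (Suc n)"
      by simp
    \<comment> \<open>The factor 1 / n! comes from the inverse of (B)_(n+1), and 1 / (n+1)! from the
      series itself; the latter turns the Pochhammer symbol into the binomial coefficient.\<close>
    then have c: "pochhammer (real (m + 1)) (Suc n) * (inverse (fact n) * inverse (fact (Suc n)))
        = real ((n + (m + 1)) choose m) / fact n"
      by (simp only: divide_inverse mult_ac)
    have "(mpoch A (Suc n) ** matrix_inv (mpoch B (Suc n)) ** mpow W (Suc n)) /\<^sub>R fact (Suc n)
        = (pochhammer (real (m + 1)) (Suc n) * (inverse (fact n) * inverse (fact (Suc n)))) *\<^sub>R
          (Z ** (beta_moment A Q (Suc n) ** (beta_moment (mat 1) B n ** (mpow W n ** W))))"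
      unfolding a matrix_inv_mpoch_Suc [OF B]
      by (simp only: matrix_simps scaleR_scaleR mpow.simps matrix_mul_assoc mult_ac)
    then show ?thesis
      unfolding c hyp_coeff_def by (simp only: matrix_simps)
  qed
  have bound: "norm (hyp_1F1 A B ((- s) *\<^sub>R Y)) \<le> norm (mat 1 :: complex^'r^'r) + norm Z * (J * K)" if s: "s \<ge> 0" for s
  proof -
    let ?W = "(- s) *\<^sub>R Y"
    define E where "E n = beta_moment (mat 1) B n ** hyp_coeff m ?W n" for n
    have E: "summable (\<lambda>n. norm (E n))"
    proof (rule summable_comparison_test')
      show "summable (\<lambda>n. (LINT t:?S|lborel. norm (beta_kernel (mat 1) B t)) * norm (hyp_coeff m ?W n))"
        by (intro summable_mult summable_norm_hyp_coeff)
      show "norm (norm (E n)) \<le> (LINT t:?S|lborel. norm (beta_kernel (mat 1) B t)) * norm (hyp_coeff m ?W n)" for n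
        unfolding E_def real_norm_def abs_norm_cancel
        by (intro order_trans [OF norm_matrix_mult_le] mult_right_mono norm_beta_moment_le
            positive_stable_one B norm_ge_zero)
    qed
    let ?f = "\<lambda>n. (mpoch A n ** matrix_inv (mpoch B n) ** mpow ?W n) /\<^sub>R fact n"
    \<comment> \<open>One factor t of t^(n+1) stays with the kernel so that its moments start at
      index 1; it is later given back to the series, where it rescales the argument to t W.\<close>
    let ?I = "LINT t:?S|lborel. (t *\<^sub>R ?k t) ** (\<Sum>n. t ^ n *\<^sub>R E n)"
    have tk: "set_integrable lborel ?S (\<lambda>t. t *\<^sub>R ?k t)"
      using set_integrable_power_scaleR [OF k, of 1] by simp
    have "(\<lambda>n. beta_moment A Q (Suc n) ** E n) sums ?I"
      using sums_power_series_integral [OF tk E] by (simp add: beta_moment_def mult.commute)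
    then have "(\<lambda>n. Z ** (beta_moment A Q (Suc n) ** E n)) sums (Z ** ?I)"
      by (rule bounded_linear.sums [OF mm.bounded_linear_right])
    then have "(\<lambda>n. ?f (Suc n)) sums (Z ** ?I)"
      unfolding term_Suc E_def .
    then have "?f sums (Z ** ?I + ?f 0)"
      by (rule sums_Suc)
    \<comment> \<open>The term split off when (B)_(n+1) is paired with moment n.\<close>
    moreover have "?f 0 = mat 1"
      by (simp add: matrix_invD(2) [of "mat 1" "mat 1"])
    ultimately have H: "hyp_1F1 A B ?W = Z ** ?I + mat 1"
      by (simp only: hyp_1F1_def sums_unique [symmetric])
    have "norm ?I \<le> (LINT t:?S|lborel. norm (?k t) * K)"
    proof (rule norm_set_integral_le)
      show "set_integrable lborel ?S (\<lambda>t. norm (?k t) * K)"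
        by (intro set_integrable_mult_left norm_k)
      fix t assume t: "t \<in> ?S"
      have "summable (\<lambda>n. t ^ n *\<^sub>R E n)"
        by (rule summable_comparison_test' [OF E])
          (use t in \<open>auto simp: mult_left_le_one_le power_le_one\<close>)
      from bounded_linear.suminf [OF bounded_linear_scaleR_right this, of t]
      have "t *\<^sub>R (\<Sum>n. t ^ n *\<^sub>R E n) = (\<Sum>n. beta_moment (mat 1) B n ** hyp_coeff m (t *\<^sub>R ?W) n)"
        unfolding hyp_coeff_scaleR E_def by (simp only: matrix_simps scaleR_scaleR power_Suc mult.assoc)
      also have "t *\<^sub>R ?W = (- (t * s)) *\<^sub>R Y"
        by simp
      finally have tE: "norm (t *\<^sub>R (\<Sum>n. t ^ n *\<^sub>R E n)) \<le> K"
        using K [of "t * s"] s t by simp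
      have "(t *\<^sub>R ?k t) ** (\<Sum>n. t ^ n *\<^sub>R E n) = ?k t ** (t *\<^sub>R (\<Sum>n. t ^ n *\<^sub>R E n))"
        by (simp only: matrix_simps)
      also have "norm \<dots> \<le> norm (?k t) * norm (t *\<^sub>R (\<Sum>n. t ^ n *\<^sub>R E n))"
        by (rule norm_matrix_mult_le)
      also have "\<dots> \<le> norm (?k t) * K"
        by (intro mult_left_mono tE norm_ge_zero)
      finally show "norm ((t *\<^sub>R ?k t) ** (\<Sum>n. t ^ n *\<^sub>R E n)) \<le> norm (?k t) * K" .
    qed
    also have "\<dots> = J * K"
      by (simp add: J_def)
    finally have "norm (Z ** ?I) \<le> norm Z * (J * K)"
      by (intro order_trans [OF norm_matrix_mult_le] mult_left_mono norm_ge_zero)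
    then show ?thesis
      unfolding H by (smt (verit) norm_triangle_ineq)
  qed
  show thesis
    by (rule that [OF bound])
qed

subsection \<open>The integral representations\<close>

lemma borel_measurable_matrix_mult:
  fixes f g :: "'a \<Rightarrow> complex^'r^'r"
  assumes "f \<in> borel_measurable M" "g \<in> borel_measurable M"
  shows "(\<lambda>x. f x ** g x) \<in> borel_measurable M"
  using assms by (rule borel_measurable_continuous_Pair)
    (intro mm.continuous_on continuous_on_fst continuous_on_snd continuous_on_id)

lemma borel_measurable_hyp_1F1:
  fixes A B Y :: "complex^'r^'r" and c :: "real \<Rightarrow> real"
  assumes [measurable]: "c \<in> borel_measurable borel"
  shows "(\<lambda>t. hyp_1F1 A B (c t *\<^sub>R Y)) \<in> borel_measurable borel"
  unfolding hyp_1F1_def mpow_scaleR mm.scaleR_right by measurable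

text \<open>The scalar 1 / (t (1 - t)) blows up at both ends, which is why a bound uniform in s
  \<ge> 0 is wanted; integrability is then inherited from the kernel.\<close>

lemma set_integrable_hyp_1F1_beta_kernel:
  fixes A B Y P Q :: "complex^'r^'r"
  assumes "positive_stable A" "positive_stable B" "positive_stable Y" "positive_stable P" "positive_stable Q"
  shows "set_integrable lborel {0<..<1} (\<lambda>t. hyp_1F1 A B (- (Y /\<^sub>R (t * (1 - t)))) ** beta_kernel P Q t)"
proof -
  let ?h = "\<lambda>t. hyp_1F1 A B (- (Y /\<^sub>R (t * (1 - t))))"
  obtain K where K: "\<And>s. s \<ge> 0 \<Longrightarrow> norm (hyp_1F1 A B ((- s) *\<^sub>R Y)) \<le> K"
    by (rule hyp_1F1_bounded [OF assms(1-3)]) (rule that)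
  have k: "set_integrable lborel {0<..<1} (beta_kernel P Q)"
    by (intro set_integrable_beta_kernel assms)
  show ?thesis
  proof (rule set_integrable_bound)
    show "set_integrable lborel {0<..<1} (\<lambda>t. K *\<^sub>R beta_kernel P Q t)"
      using k by simp
    have "(\<lambda>t. hyp_1F1 A B ((- inverse (t * (1 - t))) *\<^sub>R Y)) \<in> borel_measurable borel"
      by (rule borel_measurable_hyp_1F1) measurable
    then have "(\<lambda>t. ?h t ** (indicat_real {0<..<1} t *\<^sub>R beta_kernel P Q t)) \<in> borel_measurable lborel"
      using borel_measurable_integrable [OF k [unfolded set_integrable_def]]
      by (intro borel_measurable_matrix_mult) simp_all
    then show "set_borel_measurable lborel {0<..<1} (\<lambda>t. ?h t ** beta_kernel P Q t)"
      by (simp add: set_borel_measurable_def mm.scaleR_right)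
    show "AE t in lborel. t \<in> {0<..<1} \<longrightarrow> norm (?h t ** beta_kernel P Q t) \<le> norm (K *\<^sub>R beta_kernel P Q t)"
    proof (intro AE_I2 impI)
      fix t :: real assume "t \<in> {0<..<1}"
      then have "norm (?h t) \<le> K"
        using K [of "inverse (t * (1 - t))"] by simp
      then have "norm (?h t) * norm (beta_kernel P Q t) \<le> \<bar>K\<bar> * norm (beta_kernel P Q t)"
        by (intro mult_right_mono) auto
      then show "norm (?h t ** beta_kernel P Q t) \<le> norm (K *\<^sub>R beta_kernel P Q t)"
        using norm_matrix_mult_le order_trans by fastforce
    qed
  qed
qed

lemma
  fixes f :: "real \<Rightarrow> 'a::{banach, second_countable_topology}"
  shows set_integral_reflect_unit: "(LINT t:{0<..<1}|lborel. f (1 - t)) = (LINT t:{0<..<1}|lborel. f t)"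
    and set_integrable_reflect_unit: "set_integrable lborel {0<..<1} f \<Longrightarrow> set_integrable lborel {0<..<1} (\<lambda>t. f (1 - t))"
proof -
  have ind: "indicat_real {0<..<1} (1 - t) = indicat_real {0<..<1} t" for t :: real
    by (auto simp: indicator_def)
  show "(LINT t:{0<..<1}|lborel. f (1 - t)) = (LINT t:{0<..<1}|lborel. f t)"
    using lborel_integral_real_affine [of "- 1" "\<lambda>t. indicat_real {0<..<1} t *\<^sub>R f t" 1]
    by (simp add: set_lebesgue_integral_def ind)
  show "set_integrable lborel {0<..<1} (\<lambda>t. f (1 - t))" if "set_integrable lborel {0<..<1} f"
    using lborel_integrable_real_affine [of "\<lambda>t. indicat_real {0<..<1} t *\<^sub>R f t" "- 1" 1] that
    by (simp add: set_integrable_def ind)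
qed

text \<open>Written as a scalar matrix, the factor exp (z t) fits the exchange lemma for matrix
  power series.\<close>

lemma exp_scalar_sums:
  "(\<lambda>n. t ^ n *\<^sub>R ((z ^ n / fact n) *\<^sub>M (mat 1 :: complex^'r^'r))) sums (exp (z * of_real t) *\<^sub>M mat 1)"
proof -
  have "(\<lambda>n. ((z * of_real t) ^ n /\<^sub>R fact n) *\<^sub>M (mat 1 :: complex^'r^'r)) sums (exp (z * of_real t) *\<^sub>M mat 1)"
    by (intro bounded_linear.sums [OF cs.bounded_linear_left] exp_converges)
  moreover have "((z * of_real t) ^ n /\<^sub>R fact n) *\<^sub>M (mat 1 :: complex^'r^'r) = t ^ n *\<^sub>R ((z ^ n / fact n) *\<^sub>M mat 1)" for n
    by (simp add: cs.scaleR_left [symmetric] scaleR_conv_of_real [where 'a = complex] power_mult_distrib divide_inverse mult_ac)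
  ultimately show ?thesis
    by simp
qed

lemma summable_norm_exp_scalar: "summable (\<lambda>n. norm ((z ^ n / fact n) *\<^sub>M (mat 1 :: complex^'r^'r)))"
proof -
  have "summable (\<lambda>n. (norm z ^ n /\<^sub>R fact n) * norm (mat 1 :: complex^'r^'r))"
    by (intro summable_mult2 summable_exp_generic)
  then show ?thesis
    by (simp add: norm_cscale norm_divide norm_power field_simps)
qed

text \<open>Since t^(B1 + n I - I) = t^n t^(B1 - I), the extended beta values are the moments of one
  integrable function F, and the exchange applies with coefficients z^n / n! times the
  identity.\<close>

lemma ext_hyp_1F1_term_sums:
  fixes A B B1 C1 Y :: "complex^'r^'r" and z :: complex
  assumes "positive_stable A" and "positive_stable B" and "positive_stable B1"
    and "positive_stable (C1 - B1)" and "positive_stable Y"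
  defines "G \<equiv> (\<lambda>t. exp (z * of_real t) *\<^sub>M
      (hyp_1F1 A B (- (Y /\<^sub>R (t * (1 - t)))) ** mpowr t (B1 - mat 1) ** mpowr (1 - t) (C1 - B1 - mat 1)))"
  shows "set_integrable lborel {0<..<1} G"
    and "ext_hyp_1F1_term A B Y B1 C1 z sums
      ((LINT t:{0<..<1}|lborel. G t) ** matrix_inv (mBeta B1 (C1 - B1)))"
proof -
  let ?S = "{0<..<1::real}" and ?N = "matrix_inv (mBeta B1 (C1 - B1))"
  define F where "F t = hyp_1F1 A B (- (Y /\<^sub>R (t * (1 - t)))) ** beta_kernel B1 (C1 - B1) t" for t
  have F: "set_integrable lborel ?S F"
    unfolding F_def by (intro set_integrable_hyp_1F1_beta_kernel assms)
  define D where "D n = (z ^ n / fact n) *\<^sub>M (mat 1 :: complex^'r^'r)" for n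
  have D: "summable (\<lambda>n. norm (D n))"
    unfolding D_def by (rule summable_norm_exp_scalar)
  have G: "F t ** (\<Sum>n. t ^ n *\<^sub>R D n) = G t" for t
    unfolding D_def sums_unique [OF exp_scalar_sums, symmetric]
    by (simp add: F_def G_def beta_kernel_def cscale_mult_right matrix_mul_assoc)
  show "set_integrable lborel ?S G"
    using set_integrable_power_series [OF F D] by (simp add: G)
  have ext: "ext_Beta A B Y (B1 + real n *\<^sub>R mat 1) (C1 - B1) = (LINT t:?S|lborel. t ^ n *\<^sub>R F t)" for n
    unfolding ext_Beta_def
  proof (rule set_lebesgue_integral_cong)
    show "\<forall>t. t \<in> ?S \<longrightarrow> hyp_1F1 A B (- (Y /\<^sub>R (t * (1 - t)))) ** mpowr t (B1 + real n *\<^sub>R mat 1 - mat 1) **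
        mpowr (1 - t) (C1 - B1 - mat 1) = t ^ n *\<^sub>R F t"
    proof (intro allI impI)
      fix t :: real assume t: "t \<in> ?S"
      have "mpowr t (B1 + real n *\<^sub>R mat 1 - mat 1) = t ^ n *\<^sub>R mpowr t (B1 - mat 1)"
        using mpowr_add_scalar [of t "B1 - mat 1" "real n"] t by (simp add: powr_realpow algebra_simps)
      then show "hyp_1F1 A B (- (Y /\<^sub>R (t * (1 - t)))) ** mpowr t (B1 + real n *\<^sub>R mat 1 - mat 1) **
        mpowr (1 - t) (C1 - B1 - mat 1) = t ^ n *\<^sub>R F t"
        by (simp only: F_def beta_kernel_def mm.scaleR_left mm.scaleR_right matrix_mul_assoc)
    qed
  qed simp
  have "(\<lambda>n. (LINT t:?S|lborel. t ^ n *\<^sub>R F t) ** D n) sums (LINT t:?S|lborel. G t)"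
    using sums_power_series_integral [OF F D] by (simp add: G)
  then have "(\<lambda>n. (LINT t:?S|lborel. t ^ n *\<^sub>R F t) ** D n ** ?N) sums ((LINT t:?S|lborel. G t) ** ?N)"
    by (rule bounded_linear.sums [OF mm.bounded_linear_left])
  moreover have "(LINT t:?S|lborel. t ^ n *\<^sub>R F t) ** D n ** ?N = ext_hyp_1F1_term A B Y B1 C1 z n" for n
    by (simp add: ext_hyp_1F1_term_def ext D_def cscale_mult_right cscale_mult_left)
  ultimately show "ext_hyp_1F1_term A B Y B1 C1 z sums ((LINT t:?S|lborel. G t) ** ?N)"
    by simp
qed

text \<open>Infinite sums and integrals are total, so summability and integrability are asserted
  alongside the equations to rule out default values.\<close>

theorem theorem4p2:
  fixes A B B1 C1 Y :: "complex^'r^'r" and z :: complex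
  assumes "positive_stable A" and "positive_stable B"
    and "positive_stable B1" and "positive_stable C1"
    and "positive_stable (C1 - B1)" and "positive_stable Y"
    and "B1 ** C1 = C1 ** B1"
  shows "summable (ext_hyp_1F1_term A B Y B1 C1 z) \<and>
    set_integrable lborel {0<..<1} (\<lambda>t.
        exp (z * of_real t) *\<^sub>M
          (hyp_1F1 A B (- (Y /\<^sub>R (t * (1 - t))))
            ** mpowr t (B1 - mat 1) ** mpowr (1 - t) (C1 - B1 - mat 1))) \<and>
    ext_hyp_1F1 A B Y B1 C1 z =
      (LINT t:{0<..<1}|lborel.
        exp (z * of_real t) *\<^sub>M
          (hyp_1F1 A B (- (Y /\<^sub>R (t * (1 - t))))
            ** mpowr t (B1 - mat 1) ** mpowr (1 - t) (C1 - B1 - mat 1)))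
      ** matrix_inv (mBeta B1 (C1 - B1)) \<and>
    set_integrable lborel {0<..<1} (\<lambda>u.
        exp (z * (1 - of_real u)) *\<^sub>M
          (hyp_1F1 A B ((- Y) /\<^sub>R (u * (1 - u)))
            ** mpowr u (C1 - B1 - mat 1) ** mpowr (1 - u) (B1 - mat 1))) \<and>
    ext_hyp_1F1 A B Y B1 C1 z =
      (LINT u:{0<..<1}|lborel.
        exp (z * (1 - of_real u)) *\<^sub>M
          (hyp_1F1 A B ((- Y) /\<^sub>R (u * (1 - u)))
            ** mpowr u (C1 - B1 - mat 1) ** mpowr (1 - u) (B1 - mat 1)))
      ** matrix_inv (mBeta B1 (C1 - B1))"
proof -
  define G where "G t = exp (z * of_real t) *\<^sub>M
      (hyp_1F1 A B (- (Y /\<^sub>R (t * (1 - t)))) ** mpowr t (B1 - mat 1) ** mpowr (1 - t) (C1 - B1 - mat 1))" for t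
  have int: "set_integrable lborel {0<..<1} G"
    and sums: "ext_hyp_1F1_term A B Y B1 C1 z sums
      ((LINT t:{0<..<1}|lborel. G t) ** matrix_inv (mBeta B1 (C1 - B1)))"
    unfolding G_def using ext_hyp_1F1_term_sums [of A B B1 C1 Y z] assms by simp_all
  \<comment> \<open>The reflection fixes u (1 - u) but reverses the order of the two matrix powers;
    B1 and C1 - B1 commute, so the order can be restored.\<close>
  have eq: "exp (z * (1 - of_real u)) *\<^sub>M
      (hyp_1F1 A B ((- Y) /\<^sub>R (u * (1 - u))) ** mpowr u (C1 - B1 - mat 1) ** mpowr (1 - u) (B1 - mat 1))
    = G (1 - u)" for u
  proof -
    have "mpowr u (C1 - B1 - mat 1) ** mpowr (1 - u) (B1 - mat 1)
        = mpowr (1 - u) (B1 - mat 1) ** mpowr u (C1 - B1 - mat 1)"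
      by (rule mpowr_mpowr_commute) (simp add: matrix_simps assms(7))
    then show ?thesis
      by (simp add: G_def mult.commute [of u] flip: matrix_mul_assoc)
  qed
  show ?thesis
    unfolding G_def [symmetric] eq
    using int sums set_integrable_reflect_unit [OF int] set_integral_reflect_unit [of G]
    by (simp add: ext_hyp_1F1_def sums_iff)
qed

end
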